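(* Let $G$ be a finite transitive permutation group properly containing a regular subgroup $R$ (the domain of $G$ being identified with $R$, on which $R$ acts by right multiplication). Then one of the following holds: (a) the number of Cayley graphs $\Gamma$ on $R$ with $G\le\mathrm{Aut}(\Gamma)$ is at most $2^{\mathbf{c}(R)-\frac{|R|}{96}}$; (b) $R$ is abelian of exponent greater than $2$; (c) $R$ is generalized dicyclic.
   Context: A digraph is an ordered pair $(V,E)$ with $V$ a finite non-empty set and $E\subseteq V\times V$; it is a graph if $E$ is symmetric (loops are allowed). An automorphism is a permutation of $V$ preserving $E$. For a group $R$ and a subset $S\subseteq R$, the Cayley digraph $\Gamma(R,S)$ has vertex set $R$, and $(r,t)$ is an arc if and only if $tr^{-1}\in S$. It is a graph (a Cayley graph on $R$) if and only if $S=S^{-1}$, i.e. $S$ is inverse-closed; so Cayley graphs on $R$ correspond to inverse-closed subsets of $R$. The group $R$ acts regularly by right multiplication on $\Gamma(R,S)$ as automorphisms. $2^{\mathbf{c}(R)}$ denotes the number of inverse-closed subsets of $R$; equivalently $\mathbf{c}(R)=\frac{|R|+|\mathbf{I}(R)|}{2}$, where $\mathbf{I}(R)=\{x\in R\mid x^2=1\}$. Let $A$ be an abelian group of even order and of exponent greater than $2$, and let $y$ be an involution of $A$. The generalised dicyclic group $\mathrm{Dic}(A,y,x)$ is the group $\langle A,x\mid x^2=y,\ a^x=a^{-1}\ \forall a\in A\rangle$, where $a^x=x^{-1}ax$. A group is generalised dicyclic if it is isomorphic to some $\mathrm{Dic}(A,y,x)$. *)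

theory Defs
  imports Complex_Main "HOL-Algebra.Group_Action" "HOL-Algebra.Multiplicative_Group"
    "Graph_Theory.Pair_Digraph"
begin

section \<open>Cayley digraphs and their automorphisms\<close>

text \<open>Digraphs are pairs of a vertex set and an arc relation, with loops allowed.
  A graph in the present sense is a \<^const>\<open>pair_pseudo_graph\<close>.
  A permutation of \<open>V\<close> is an element of \<^term>\<open>Bij V\<close>: outside \<open>V\<close> it is \<open>undefined\<close>.\<close>

definition digraph_auts :: "'a pair_pre_digraph \<Rightarrow> ('a \<Rightarrow> 'a) set" where
  "digraph_auts \<Gamma> = {f \<in> Bij (pverts \<Gamma>).
     \<forall>u\<in>pverts \<Gamma>. \<forall>v\<in>pverts \<Gamma>. (f u, f v) \<in> parcs \<Gamma> \<longleftrightarrow> (u, v) \<in> parcs \<Gamma>}"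

definition cayley_digraph :: "('a, 'b) monoid_scheme \<Rightarrow> 'a set \<Rightarrow> 'a pair_pre_digraph" where
  "cayley_digraph R S =
     \<lparr>pverts = carrier R,
      parcs = {(r, t) \<in> carrier R \<times> carrier R. t \<otimes>\<^bsub>R\<^esub> inv\<^bsub>R\<^esub> r \<in> S}\<rparr>"

definition cayley_graphs :: "('a, 'b) monoid_scheme \<Rightarrow> 'a pair_pre_digraph set" where
  "cayley_graphs R = {\<Gamma>. pair_pseudo_graph \<Gamma> \<and> (\<exists>S \<subseteq> carrier R. \<Gamma> = cayley_digraph R S)}"

definition right_regular :: "('a, 'b) monoid_scheme \<Rightarrow> ('a \<Rightarrow> 'a) set" where
  "right_regular R = (\<lambda>r. \<lambda>x\<in>carrier R. x \<otimes>\<^bsub>R\<^esub> r) ` carrier R"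

definition inverse_closed_subsets :: "('a, 'b) monoid_scheme \<Rightarrow> 'a set set" where
  "inverse_closed_subsets R = {S. S \<subseteq> carrier R \<and> set_inv\<^bsub>R\<^esub> S = S}"

text \<open>\<open>\<c>(R)\<close> is defined by \<open>2\<^bsup>\<c>(R)\<^esup> = |inverse_closed_subsets R|\<close>;
  the closed form is proved in \<open>cayley_exponent_eq\<close> below.\<close>

definition cayley_exponent :: "('a, 'b) monoid_scheme \<Rightarrow> real" where
  "cayley_exponent R = log 2 (real (card (inverse_closed_subsets R)))"

section \<open>Generalised dicyclic groups\<close>

text \<open>Only meaningful for groups of finite exponent, in particular for finite groups.\<close>

definition group_exponent :: "('a, 'b) monoid_scheme \<Rightarrow> nat" where
  "group_exponent G = (LEAST n. n > 0 \<and> (\<forall>g\<in>carrier G. g [^]\<^bsub>G\<^esub> n = \<one>\<^bsub>G\<^esub>))"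

text \<open>The group given by generators \<open>gens\<close> and relations \<open>rels\<close>. In a word, \<open>(g, True)\<close> stands
  for the generator \<open>g\<close> and \<open>(g, False)\<close> for its formal inverse; a pair \<open>(l, r) \<in> rels\<close>
  is the relation \<open>l = r\<close>.\<close>

type_synonym 'g gen_word = "('g \<times> bool) list"

inductive_set pres_rel :: "'g set \<Rightarrow> ('g gen_word \<times> 'g gen_word) set \<Rightarrow> ('g gen_word \<times> 'g gen_word) set"
  for gens rels where
  refl: "w \<in> lists (gens \<times> UNIV) \<Longrightarrow> (w, w) \<in> pres_rel gens rels"
| sym: "(v, w) \<in> pres_rel gens rels \<Longrightarrow> (w, v) \<in> pres_rel gens rels"
| trans: "(u, v) \<in> pres_rel gens rels \<Longrightarrow> (v, w) \<in> pres_rel gens rels \<Longrightarrow> (u, w) \<in> pres_rel gens rels"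
| cancel: "u \<in> lists (gens \<times> UNIV) \<Longrightarrow> v \<in> lists (gens \<times> UNIV) \<Longrightarrow> g \<in> gens \<Longrightarrow>
    (u @ [(g, b), (g, \<not> b)] @ v, u @ v) \<in> pres_rel gens rels"
| rel: "u \<in> lists (gens \<times> UNIV) \<Longrightarrow> v \<in> lists (gens \<times> UNIV) \<Longrightarrow> (l, r) \<in> rels \<Longrightarrow>
    l \<in> lists (gens \<times> UNIV) \<Longrightarrow> r \<in> lists (gens \<times> UNIV) \<Longrightarrow>
    (u @ l @ v, u @ r @ v) \<in> pres_rel gens rels"

definition presented_group ::
  "'g set \<Rightarrow> ('g gen_word \<times> 'g gen_word) set \<Rightarrow> 'g gen_word set monoid" where
  "presented_group gens rels =
     \<lparr>carrier = lists (gens \<times> UNIV) // pres_rel gens rels,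
      monoid.mult = (\<lambda>C D. \<Union>u\<in>C. \<Union>v\<in>D. pres_rel gens rels `` {u @ v}),
      one = pres_rel gens rels `` {[]}\<rparr>"

text \<open>\<open>\<langle>A, x | x\<^sup>2 = y, x\<^sup>-\<^sup>1ax = a\<^sup>-\<^sup>1 (a \<in> A)\<rangle>\<close>: the generator \<open>x\<close> is \<^const>\<open>None\<close>,
  and the first set of relations is the multiplication table of \<open>A\<close>.\<close>

definition Dic :: "('a, 'b) monoid_scheme \<Rightarrow> 'a \<Rightarrow> 'a option gen_word set monoid" where
  "Dic A y = presented_group (insert None (Some ` carrier A))
     ({([(Some a, True), (Some b, True)], [(Some (a \<otimes>\<^bsub>A\<^esub> b), True)]) | a b.
         a \<in> carrier A \<and> b \<in> carrier A}
      \<union> {([(None, True), (None, True)], [(Some y, True)])}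
      \<union> {([(None, False), (Some a, True), (None, True)], [(Some (inv\<^bsub>A\<^esub> a), True)]) | a.
           a \<in> carrier A})"

text \<open>Letting \<open>A\<close> range over groups on the element type of \<open>R\<close> loses nothing, because
  \<open>A\<close> embeds into \<^term>\<open>Dic A y\<close>, hence into \<open>R\<close>.\<close>

definition generalised_dicyclic :: "('a, 'b) monoid_scheme \<Rightarrow> bool" where
  "generalised_dicyclic R \<longleftrightarrow>
     (\<exists>(A :: 'a monoid) y. comm_group A \<and> finite (carrier A) \<and> even (order A)
        \<and> group_exponent A > 2 \<and> y \<in> carrier A \<and> group.ord A y = 2 \<and> R \<cong> Dic A y)"

section \<open>Consistency of the definitions\<close>

lemma (in group) set_inv_eq_iff:
  assumes "S \<subseteq> carrier G"
  shows "set_inv S = S \<longleftrightarrow> (\<forall>s\<in>S. inv s \<in> S)"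
proof
  assume "set_inv S = S" then show "\<forall>s\<in>S. inv s \<in> S" unfolding SET_INV_def by blast
next
  assume h: "\<forall>s\<in>S. inv s \<in> S"
  moreover have "s \<in> set_inv S" if "s \<in> S" for s
    using that h assms unfolding SET_INV_def by (auto intro!: bexI[of _ "inv s"])
  ultimately show "set_inv S = S" unfolding SET_INV_def by blast
qed

lemma (in group) cayley_digraph_graph_iff:
  assumes "finite (carrier G)" "S \<subseteq> carrier G"
  shows "pair_pseudo_graph (cayley_digraph G S) \<longleftrightarrow> set_inv S = S"
proof -
  have fin: "pair_fin_digraph (cayley_digraph G S)"
    unfolding cayley_digraph_def using assms(1)
    by unfold_locales (auto intro: finite_subset[of _ "carrier G \<times> carrier G"])
  have "sym (parcs (cayley_digraph G S)) \<longleftrightarrow> (\<forall>s\<in>S. inv s \<in> S)"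
  proof
    assume h: "sym (parcs (cayley_digraph G S))"
    show "\<forall>s\<in>S. inv s \<in> S"
    proof
      fix s assume s: "s \<in> S"
      then have "(\<one>, s) \<in> parcs (cayley_digraph G S)"
        using assms by (auto simp: cayley_digraph_def)
      with h have "(s, \<one>) \<in> parcs (cayley_digraph G S)" by (auto dest: symD)
      then show "inv s \<in> S" by (auto simp: cayley_digraph_def)
    qed
  next
    assume h: "\<forall>s\<in>S. inv s \<in> S"
    show "sym (parcs (cayley_digraph G S))"
    proof (rule symI)
      fix r t assume "(r, t) \<in> parcs (cayley_digraph G S)"
      then have rt: "r \<in> carrier G" "t \<in> carrier G" "t \<otimes> inv r \<in> S"
        by (auto simp: cayley_digraph_def)
      then have "inv (t \<otimes> inv r) \<in> S" using h by blast
      then show "(t, r) \<in> parcs (cayley_digraph G S)"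
        using rt by (simp add: cayley_digraph_def inv_mult_group)
    qed
  qed
  moreover have "pair_pseudo_graph (cayley_digraph G S) \<longleftrightarrow> sym (parcs (cayley_digraph G S))"
    using fin unfolding pair_pseudo_graph_def pair_sym_digraph_def pair_sym_digraph_axioms_def
      pair_fin_digraph_def by (simp add: symmetric_def)
  ultimately show ?thesis using set_inv_eq_iff[OF assms(2)] by simp
qed

lemma (in group) cayley_digraph_inj: "inj_on (cayley_digraph G) (Pow (carrier G))"
proof (rule inj_onI)
  fix S T assume h: "S \<in> Pow (carrier G)" "T \<in> Pow (carrier G)"
    and eq: "cayley_digraph G S = cayley_digraph G T"
  have *: "U = {s. (\<one>, s) \<in> parcs (cayley_digraph G U)}" if "U \<in> Pow (carrier G)" for U
    using that by (auto simp: cayley_digraph_def)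
  show "S = T" using *[OF h(1)] *[OF h(2)] eq by metis
qed

lemma (in group) cayley_exponent_eq:
  assumes fin: "finite (carrier G)"
  shows "cayley_exponent G =
    real (order G + card {x \<in> carrier G. x [^] (2::nat) = \<one>}) / 2"
proof -
  define c where "c x = {x, inv x}" for x
  define P where "P = c ` carrier G"
  have cx: "x \<in> c x" "inv x \<in> c x" for x by (auto simp: c_def)
  have finP: "finite P" using fin by (simp add: P_def)
  have cinv: "c (inv x) = c x" if "x \<in> carrier G" for x using that by (auto simp: c_def)
  have uniq: "c y = c x" if "x \<in> carrier G" "y \<in> c x" for x y
    using that cinv by (auto simp: c_def)
  have bij: "bij_betw (\<lambda>Q. \<Union>Q) (Pow P) (inverse_closed_subsets G)"
  proof (rule bij_betw_byWitness[where f' = "\<lambda>S. c ` S"])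
    show "\<forall>Q\<in>Pow P. c ` \<Union>Q = Q"
    proof
      fix Q assume Q: "Q \<in> Pow P"
      show "c ` \<Union>Q = Q"
      proof (intro equalityI subsetI)
        fix B assume "B \<in> c ` \<Union>Q"
        then obtain y C where y: "B = c y" "y \<in> C" "C \<in> Q" by blast
        with Q obtain x where "x \<in> carrier G" "C = c x" by (auto simp: P_def)
        with y uniq show "B \<in> Q" by metis
      next
        fix B assume B: "B \<in> Q"
        with Q obtain x where "B = c x" by (auto simp: P_def)
        with B cx show "B \<in> c ` \<Union>Q" by blast
      qed
    qed
    show "\<forall>S\<in>inverse_closed_subsets G. \<Union> (c ` S) = S"
      by (auto simp: inverse_closed_subsets_def set_inv_eq_iff c_def)
    show "(\<lambda>Q. \<Union>Q) ` Pow P \<subseteq> inverse_closed_subsets G"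
    proof clarify
      fix Q assume Q: "Q \<subseteq> P"
      have sub: "\<Union>Q \<subseteq> carrier G" using Q by (auto simp: P_def c_def)
      have "inv s \<in> \<Union>Q" if "s \<in> B" "B \<in> Q" for s B
        using that Q by (auto simp: P_def c_def intro!: bexI[of _ B])
      then show "\<Union>Q \<in> inverse_closed_subsets G"
        using sub by (auto simp: inverse_closed_subsets_def set_inv_eq_iff)
    qed
    show "(\<lambda>S. c ` S) ` inverse_closed_subsets G \<subseteq> Pow P"
      by (auto simp: inverse_closed_subsets_def P_def)
  qed
  define I where "I = {x \<in> carrier G. x [^] (2::nat) = \<one>}"
  have Iff: "x \<in> I \<longleftrightarrow> inv x = x" if "x \<in> carrier G" for x
  proof -
    have "x [^] (2::nat) = x \<otimes> x" using that by (simp add: numeral_2_eq_2)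
    moreover have "x \<otimes> x = \<one> \<longleftrightarrow> inv x = x"
      using that inv_equality[of x x] r_inv[of x] by metis
    ultimately show ?thesis using that by (simp add: I_def)
  qed
  have dis: "B \<inter> C = {}" if "B \<in> P" "C \<in> P" "B \<noteq> C" for B C
    using that uniq unfolding P_def by (metis disjoint_iff imageE)
  have un: "carrier G = \<Union>P" by (auto simp: P_def c_def)
  have "order G = (\<Sum>B\<in>P. card B)" unfolding order_def un
    by (rule card_Union_disjoint) (auto simp: pairwise_def disjnt_def dis P_def c_def)
  moreover have "card I = (\<Sum>B\<in>P. card (B \<inter> I))"
  proof -
    have "I = (\<Union>B\<in>P. B \<inter> I)" using un by (auto simp: I_def)
    then have "card I = card (\<Union>B\<in>P. B \<inter> I)" by simp
    also have "\<dots> = (\<Sum>B\<in>P. card (B \<inter> I))"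
      by (rule card_UN_disjoint) (use finP dis in \<open>auto simp: P_def c_def\<close>)
    finally show ?thesis .
  qed
  moreover have "card B + card (B \<inter> I) = 2" if "B \<in> P" for B
  proof -
    from that obtain x where x: "x \<in> carrier G" "B = {x, inv x}" by (auto simp: P_def c_def)
    show ?thesis
    proof (cases "inv x = x")
      case True then show ?thesis using x Iff by auto
    next
      case False
      then have "B \<inter> I = {}" using x Iff[of x] Iff[of "inv x"] by auto
      then show ?thesis using x False by (auto simp: card_insert_if)
    qed
  qed
  ultimately have "order G + card I = 2 * card P" by (simp flip: sum.distrib)
  moreover have "card (inverse_closed_subsets G) = 2 ^ card P"
    using bij_betw_same_card[OF bij] card_Pow[OF finP] by simp
  ultimately show ?thesis unfolding cayley_exponent_def I_def[symmetric]
    by (simp add: log_nat_power)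
qed

lemma pres_rel_words:
  "(v, w) \<in> pres_rel gens rels \<Longrightarrow> v \<in> lists (gens \<times> UNIV) \<and> w \<in> lists (gens \<times> UNIV)"
  by (induction rule: pres_rel.induct) auto

lemma equiv_pres_rel: "equiv (lists (gens \<times> UNIV)) (pres_rel gens rels)"
  by (rule equivI)
    (auto simp: refl_on_def sym_def trans_def
      intro: pres_rel.refl pres_rel.sym pres_rel.trans dest: pres_rel_words)

lemma pres_rel_append:
  assumes "(v, w) \<in> pres_rel gens rels" "p \<in> lists (gens \<times> UNIV)" "q \<in> lists (gens \<times> UNIV)"
  shows "(p @ v @ q, p @ w @ q) \<in> pres_rel gens rels"
  using assms
proof (induction rule: pres_rel.induct)
  case (cancel u v g b)
  then show ?case
    using pres_rel.cancel[of "p @ u" gens "v @ q" g b rels] by simp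
next
  case (rel u v l r)
  then show ?case
    using pres_rel.rel[of "p @ u" gens "v @ q" l r rels] by simp
next
  case (refl w)
  then show ?case by (intro pres_rel.refl) auto
qed (auto intro: pres_rel.sym pres_rel.trans)

lemma pres_rel_append2:
  assumes "(u, u') \<in> pres_rel gens rels" "(v, v') \<in> pres_rel gens rels"
  shows "(u @ v, u' @ v') \<in> pres_rel gens rels"
  using pres_rel_append[OF assms(1), of "[]" v] pres_rel_append[OF assms(2), of u' "[]"]
    pres_rel_words[OF assms(1)] pres_rel_words[OF assms(2)]
  by (auto intro: pres_rel.trans)

lemma presented_group_mult:
  assumes "u \<in> lists (gens \<times> UNIV)" "v \<in> lists (gens \<times> UNIV)"
  shows "pres_rel gens rels `` {u} \<otimes>\<^bsub>presented_group gens rels\<^esub> pres_rel gens rels `` {v}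
    = pres_rel gens rels `` {u @ v}"
proof -
  have "congruent2 (pres_rel gens rels) (pres_rel gens rels) (\<lambda>u v. pres_rel gens rels `` {u @ v})"
    by (auto simp: congruent2_def intro!: equiv_class_eq[OF equiv_pres_rel] pres_rel_append2)
  from UN_equiv_class2[OF equiv_pres_rel equiv_pres_rel this assms]
  show ?thesis by (simp add: presented_group_def)
qed

lemma pres_rel_inverse:
  assumes "w \<in> lists (gens \<times> UNIV)"
  shows "(rev (map (\<lambda>(g, b). (g, \<not> b)) w) @ w, []) \<in> pres_rel gens rels"
  using assms
proof (induction w rule: list.induct)
  case Nil
  then show ?case by (auto intro: pres_rel.refl)
next
  case (Cons gb w)
  obtain g b where gb: "gb = (g, b)" by (cases gb)
  have "w \<in> lists (gens \<times> UNIV)" using Cons.prems by simp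
  then have "rev (map (\<lambda>(g, b). (g, \<not> b)) w) \<in> lists (gens \<times> UNIV)" by fastforce
  then have "(rev (map (\<lambda>(g, b). (g, \<not> b)) w) @ [(g, \<not> b), (g, \<not> \<not> b)] @ w,
      rev (map (\<lambda>(g, b). (g, \<not> b)) w) @ w) \<in> pres_rel gens rels"
    using Cons.prems gb by (intro pres_rel.cancel) auto
  then show ?case using Cons gb by (auto intro: pres_rel.trans)
qed

lemma group_presented_group: "group (presented_group gens rels)"
proof -
  let ?r = "pres_rel gens rels" and ?P = "presented_group gens rels"
  define W :: "'a gen_word set" where "W = lists (gens \<times> UNIV)"
  have car: "carrier ?P = (\<lambda>w. ?r `` {w}) ` W"
    by (auto simp: presented_group_def quotient_def W_def)
  have one: "\<one>\<^bsub>?P\<^esub> = ?r `` {[]}" by (simp add: presented_group_def)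
  have W: "[] \<in> W" "\<And>u v. u \<in> W \<Longrightarrow> v \<in> W \<Longrightarrow> u @ v \<in> W" by (auto simp: W_def)
  have mult: "?r `` {u} \<otimes>\<^bsub>?P\<^esub> ?r `` {v} = ?r `` {u @ v}" if "u \<in> W" "v \<in> W" for u v
    using that unfolding W_def by (rule presented_group_mult)
  show ?thesis
  proof (rule groupI)
    fix x assume "x \<in> carrier ?P"
    then obtain w where w: "w \<in> W" "x = ?r `` {w}" by (auto simp: car)
    let ?v = "rev (map (\<lambda>(g, b). (g, \<not> b)) w)"
    have v: "?v \<in> W" using w by (fastforce simp: W_def)
    have "?r `` {?v} \<otimes>\<^bsub>?P\<^esub> x = \<one>\<^bsub>?P\<^esub>"
      unfolding w(2) one mult[OF v w(1)]
      using w(1) by (intro equiv_class_eq[OF equiv_pres_rel pres_rel_inverse]) (simp add: W_def)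
    then show "\<exists>y\<in>carrier ?P. y \<otimes>\<^bsub>?P\<^esub> x = \<one>\<^bsub>?P\<^esub>" using v unfolding car by blast
  qed (auto simp: car one mult W)
qed

end

theory Submission
  imports Defs
begin

text \<open>
  Let \<open>G\<^sub>1\<close> be the stabiliser of the identity in \<open>G\<close>. A Cayley graph with connection set \<open>S\<close> is
  \<open>G\<close>-invariant only if \<open>S\<close> is a union of \<open>G\<^sub>1\<close>-orbits. Let \<open>X\<close> be the set of those \<open>x \<in> R\<close> that every
  element of \<open>G\<^sub>1\<close> fixes or inverts, and \<open>F \<subseteq> X\<close> the set of common fixed points. An element \<open>x\<close> outside
  \<open>X\<close> forces the class \<open>{x, x\<^sup>-\<^sup>1}\<close> to be merged with another one, and this lowers the exponent of the
  number of admissible \<open>S\<close> by at least a quarter for each such element (\<open>card_inverse_closed_family_le\<close>).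
  Hence the bound holds as soon as \<open>|R - X| \<ge> |R|/24\<close>, and the task is to determine \<open>R\<close> when
  \<open>|R - X| < |R|/24\<close>.

  The elements of \<open>G\<^sub>1\<close> need not be automorphisms of \<open>R\<close>, but for \<open>g \<in> G\<^sub>1\<close> and \<open>x \<in> R\<close> there is
  \<open>g' \<in> G\<^sub>1\<close> with \<open>g(yx) = g'(y) g(x)\<close> for all \<open>y\<close> (\<open>stab_cocycle\<close>). So \<open>F\<close> is a subgroup, proper
  because \<open>G\<^sub>1\<close> is nontrivial; and if \<open>y\<close>, \<open>x\<close> and \<open>yx\<close> lie in \<open>X\<close> and \<open>yx\<close> does not lie in \<open>F\<close>, then
  \<open>(yx)\<^sup>-\<^sup>1\<close> is a product of one of \<open>y, y\<^sup>-\<^sup>1\<close> with one of \<open>x, x\<^sup>-\<^sup>1\<close>. Everything else is group theory with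
  this relation (locale \<open>dense_inverted\<close>): a condition such as \<open>yx \<in> X\<close> fails for fewer than
  \<open>|R|/24\<close> of the \<open>y\<close>, so generic elements satisfy several of them at once (\<open>ex_good\<close>).

  If \<open>f \<in> F\<close> and \<open>y\<close> is generic outside \<open>F\<close>, the relation says that \<open>y\<close> inverts \<open>f\<close>. It follows that
  \<open>F\<close> is abelian and that every element of \<open>R\<close> centralises or inverts each \<open>f \<in> F\<close>. If some \<open>f\<close> has
  order greater than two, its centraliser has index two and is equal to \<open>F\<close>. Then \<open>R\<close> is generalised
  dicyclic over \<open>F\<close> (\<open>dicyclic_of_F_exponent_gt_2\<close>).

  Otherwise \<open>F\<close> is central. If \<open>R\<close> is abelian, it has exponent greater than two because some element of
  \<open>X\<close> differs from its inverse. If not, the relation shows that two generic elements either commute or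
  generate a quaternion group (\<open>quaternion_pair\<close>), and \<open>R\<close> is generalised dicyclic over the centraliser
  of any noncentral element of \<open>X\<close> (\<open>dicyclic\<close>).
\<close>

section \<open>Recognising generalised dicyclic groups\<close>

definition (in group) word_eval :: "('g \<Rightarrow> 'a) \<Rightarrow> 'g gen_word \<Rightarrow> 'a" where
  "word_eval \<phi> w = foldr (\<lambda>(g, b) r. (if b then \<phi> g else inv \<phi> g) \<otimes> r) w \<one>"

lemma (in group) word_eval_simps [simp]:
  "word_eval \<phi> [] = \<one>"
  "word_eval \<phi> ((g, b) # w) = (if b then \<phi> g else inv \<phi> g) \<otimes> word_eval \<phi> w"
  by (simp_all add: word_eval_def)

lemma (in group) word_eval_closed:
  assumes "\<phi> \<in> gens \<rightarrow> carrier G" "w \<in> lists (gens \<times> UNIV)"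
  shows "word_eval \<phi> w \<in> carrier G"
  using assms(2) by (induction w) (use assms(1) in \<open>auto simp: Pi_iff\<close>)

lemma (in group) word_eval_append:
  assumes \<phi>: "\<phi> \<in> gens \<rightarrow> carrier G"
    and "v \<in> lists (gens \<times> UNIV)" "w \<in> lists (gens \<times> UNIV)"
  shows "word_eval \<phi> (v @ w) = word_eval \<phi> v \<otimes> word_eval \<phi> w"
  using assms(2)
proof (induction v)
  case Nil
  then show ?case using word_eval_closed[OF \<phi> assms(3)] by simp
next
  case (Cons p v)
  obtain g b where p: "p = (g, b)" by (cases p)
  have "\<phi> g \<in> carrier G" using Cons.hyps p \<phi> by auto
  then show ?case
    using Cons word_eval_closed[OF \<phi>] assms(3) p by (auto simp: m_assoc)
qed

lemma (in group) word_eval_pres_rel: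
  assumes \<phi>: "\<phi> \<in> gens \<rightarrow> carrier G"
    and rels: "\<And>l r. (l, r) \<in> rels \<Longrightarrow> word_eval \<phi> l = word_eval \<phi> r"
    and "(v, w) \<in> pres_rel gens rels"
  shows "word_eval \<phi> v = word_eval \<phi> w"
  using assms(3)
proof (induction rule: pres_rel.induct)
  case (cancel u v g b)
  have g: "\<phi> g \<in> carrier G" using cancel \<phi> by auto
  have v: "word_eval \<phi> v \<in> carrier G" using word_eval_closed[OF \<phi>] cancel by auto
  have "word_eval \<phi> ([(g, b), (g, \<not> b)] @ v) = word_eval \<phi> v"
    using g v by (cases b) (simp_all add: m_assoc[symmetric])
  moreover have "[(g, b), (g, \<not> b)] @ v \<in> lists (gens \<times> UNIV)" using cancel by auto
  ultimately show ?case using word_eval_append[OF \<phi>] cancel by metis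
next
  case (rel u v l r)
  then show ?case using word_eval_append[OF \<phi>] rels[OF rel(3)] by simp
qed auto

text \<open>The universal property of a group given by generators and relations (von Dyck).\<close>

lemma (in group) presented_group_hom:
  assumes \<phi>: "\<phi> \<in> gens \<rightarrow> carrier G"
    and rels: "\<And>l r. (l, r) \<in> rels \<Longrightarrow> word_eval \<phi> l = word_eval \<phi> r"
  obtains h where "h \<in> hom (presented_group gens rels) G"
    and "\<And>w. w \<in> lists (gens \<times> UNIV) \<Longrightarrow> h (pres_rel gens rels `` {w}) = word_eval \<phi> w"
proof
  let ?r = "pres_rel gens rels"
  define h where "h C = the_elem (word_eval \<phi> ` C)" for C
  show h: "h (?r `` {w}) = word_eval \<phi> w" if "w \<in> lists (gens \<times> UNIV)" for w
  proof -
    have "word_eval \<phi> v = word_eval \<phi> w" if "v \<in> ?r `` {w}" for v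
      using word_eval_pres_rel[OF \<phi> rels, of rels w v] that by simp
    moreover have "w \<in> ?r `` {w}" using pres_rel.refl[OF that, of rels] by simp
    ultimately have "word_eval \<phi> ` (?r `` {w}) = {word_eval \<phi> w}" by blast
    then show ?thesis by (simp add: h_def)
  qed
  have car: "carrier (presented_group gens rels) = (\<lambda>w. ?r `` {w}) ` lists (gens \<times> UNIV)"
    by (auto simp: presented_group_def quotient_def)
  show "h \<in> hom (presented_group gens rels) G"
  proof (rule homI)
    fix C assume "C \<in> carrier (presented_group gens rels)"
    then obtain w where "w \<in> lists (gens \<times> UNIV)" "C = ?r `` {w}" unfolding car by blast
    then show "h C \<in> carrier G" using h[of w] word_eval_closed[OF \<phi>, of w] by simp
  next
    fix C D assume "C \<in> carrier (presented_group gens rels)" "D \<in> carrier (presented_group gens rels)"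
    then obtain u v where uv: "u \<in> lists (gens \<times> UNIV)" "v \<in> lists (gens \<times> UNIV)"
      "C = ?r `` {u}" "D = ?r `` {v}" unfolding car by blast
    then show "h (C \<otimes>\<^bsub>presented_group gens rels\<^esub> D) = h C \<otimes> h D"
      using presented_group_mult[OF uv(1,2), of rels] word_eval_append[OF \<phi> uv(1,2)]
        h[OF uv(1)] h[OF uv(2)] h[of "u @ v"] uv by simp
  qed
qed

lemma presented_group_Cons:
  assumes "g \<in> gens" "w \<in> lists (gens \<times> UNIV)"
  shows "pres_rel gens rels `` {(g, b) # w} =
    (if b then pres_rel gens rels `` {[(g, True)]}
     else inv\<^bsub>presented_group gens rels\<^esub> (pres_rel gens rels `` {[(g, True)]}))
    \<otimes>\<^bsub>presented_group gens rels\<^esub> pres_rel gens rels `` {w}"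
proof -
  let ?r = "pres_rel gens rels" and ?P = "presented_group gens rels"
  interpret P: group ?P by (rule group_presented_group)
  have car: "?r `` {v} \<in> carrier ?P" if "v \<in> lists (gens \<times> UNIV)" for v
    using that by (auto simp: presented_group_def quotient_def)
  have "?r `` {[(g, False)]} \<otimes>\<^bsub>?P\<^esub> ?r `` {[(g, True)]} = ?r `` {[(g, False)] @ [(g, True)]}"
    using assms by (intro presented_group_mult) auto
  also have "\<dots> = ?r `` {[]}"
    using pres_rel.cancel[of "[]" gens "[]" g False rels] assms(1)
    by (intro equiv_class_eq[OF equiv_pres_rel]) auto
  finally have "?r `` {[(g, False)]} \<otimes>\<^bsub>?P\<^esub> ?r `` {[(g, True)]} = \<one>\<^bsub>?P\<^esub>"
    by (simp add: presented_group_def)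
  then have "?r `` {[(g, False)]} = inv\<^bsub>?P\<^esub> (?r `` {[(g, True)]})"
    using assms car by (intro P.inv_equality[symmetric]) auto
  moreover have "?r `` {[(g, b)] @ w} = ?r `` {[(g, b)]} \<otimes>\<^bsub>?P\<^esub> ?r `` {w}"
    using assms by (intro presented_group_mult[symmetric]) auto
  ultimately show ?thesis by (cases b) simp_all
qed

definition Dic_gens :: "('a, 'b) monoid_scheme \<Rightarrow> 'a option set" where
  "Dic_gens A = insert None (Some ` carrier A)"

definition Dic_rels ::
  "('a, 'b) monoid_scheme \<Rightarrow> 'a \<Rightarrow> ('a option gen_word \<times> 'a option gen_word) set" where
  "Dic_rels A y =
     {([(Some a, True), (Some b, True)], [(Some (a \<otimes>\<^bsub>A\<^esub> b), True)]) | a b.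
         a \<in> carrier A \<and> b \<in> carrier A}
      \<union> {([(None, True), (None, True)], [(Some y, True)])}
      \<union> {([(None, False), (Some a, True), (None, True)], [(Some (inv\<^bsub>A\<^esub> a), True)]) | a.
           a \<in> carrier A}"

lemma Dic_eq: "Dic A y = presented_group (Dic_gens A) (Dic_rels A y)"
  by (simp add: Dic_def Dic_gens_def Dic_rels_def)

text \<open>The relations let every \<open>x\<close> be moved to the left of a word and collected into at most one
  copy, so that \<^term>\<open>Dic A y\<close> has no elements besides those of \<open>A \<union> xA\<close>. This bounds the
  presented group from above; the universal property only bounds it from below.\<close>

lemma Dic_normal_form:
  fixes A :: "('a, 'b) monoid_scheme" and y :: 'a
  defines "gens \<equiv> Dic_gens A" and "rels \<equiv> Dic_rels A y"
  assumes A: "group A" and y: "y \<in> carrier A"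
  shows "pres_rel gens rels `` {[(Some \<one>\<^bsub>A\<^esub>, True)]} = \<one>\<^bsub>Dic A y\<^esub>"
    and "C \<in> carrier (Dic A y) \<Longrightarrow>
      \<exists>a\<in>carrier A. C = pres_rel gens rels `` {[(Some a, True)]}
        \<or> C = pres_rel gens rels `` {[(None, True), (Some a, True)]}"
proof -
  interpret A: group A by (rule A)
  let ?r = "pres_rel gens rels"
  let ?P = "presented_group gens rels"
  interpret P: group ?P by (rule group_presented_group)
  have Dic: "Dic A y = ?P" by (simp add: Dic_eq gens_def rels_def)
  define cl where "cl w = ?r `` {w}" for w
  define \<alpha> where "\<alpha> a = cl [(Some a, True)]" for a
  define X where "X = cl [(None, True)]"
  have gens [simp]: "None \<in> gens" "\<And>a. Some a \<in> gens \<longleftrightarrow> a \<in> carrier A" by (auto simp: gens_def Dic_gens_def)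
  have car: "carrier ?P = cl ` lists (gens \<times> UNIV)"
    by (auto simp: presented_group_def quotient_def cl_def)
  have \<alpha>c [simp]: "\<alpha> a \<in> carrier ?P" if "a \<in> carrier A" for a
    using that unfolding \<alpha>_def car by (intro imageI) auto
  have Xc [simp]: "X \<in> carrier ?P" unfolding X_def car by (intro imageI) auto
  have one: "cl [] = \<one>\<^bsub>?P\<^esub>" by (simp add: cl_def presented_group_def)
  have cl_Cons: "cl ((g, b) # w) = (if b then cl [(g, True)] else inv\<^bsub>?P\<^esub> (cl [(g, True)])) \<otimes>\<^bsub>?P\<^esub> cl w"
    if "g \<in> gens" "w \<in> lists (gens \<times> UNIV)" for g b w
    using presented_group_Cons[OF that] by (simp add: cl_def)
  have rel: "cl l = cl r" if "(l, r) \<in> rels" "l \<in> lists (gens \<times> UNIV)" "r \<in> lists (gens \<times> UNIV)" for l r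
    using pres_rel.rel[of "[]" gens "[]" l r rels] that unfolding cl_def
    by (intro equiv_class_eq[OF equiv_pres_rel]) auto
  have \<alpha>m: "\<alpha> a \<otimes>\<^bsub>?P\<^esub> \<alpha> b = \<alpha> (a \<otimes>\<^bsub>A\<^esub> b)" if "a \<in> carrier A" "b \<in> carrier A" for a b
  proof -
    have "cl [(Some a, True), (Some b, True)] = cl [(Some (a \<otimes>\<^bsub>A\<^esub> b), True)]"
      using that by (intro rel) (auto simp: rels_def Dic_rels_def)
    then show ?thesis using cl_Cons[of "Some a" "[(Some b, True)]" True] that by (simp add: \<alpha>_def)
  qed
  have XX: "X \<otimes>\<^bsub>?P\<^esub> X = \<alpha> y"
  proof -
    have "cl [(None, True), (None, True)] = cl [(Some y, True)]"
      using y by (intro rel) (auto simp: rels_def Dic_rels_def)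
    then show ?thesis using cl_Cons[of "None" "[(None, True)]" True] by (simp add: \<alpha>_def X_def)
  qed
  have XaX: "inv\<^bsub>?P\<^esub> X \<otimes>\<^bsub>?P\<^esub> (\<alpha> a \<otimes>\<^bsub>?P\<^esub> X) = \<alpha> (inv\<^bsub>A\<^esub> a)" if "a \<in> carrier A" for a
  proof -
    have "cl [(None, False), (Some a, True), (None, True)] = cl [(Some (inv\<^bsub>A\<^esub> a), True)]"
      using that by (intro rel) (auto simp: rels_def Dic_rels_def)
    then show ?thesis
      using cl_Cons[of "None" "[(Some a, True), (None, True)]" False]
        cl_Cons[of "Some a" "[(None, True)]" True] that by (simp add: \<alpha>_def X_def)
  qed
  have aX: "\<alpha> a \<otimes>\<^bsub>?P\<^esub> X = X \<otimes>\<^bsub>?P\<^esub> \<alpha> (inv\<^bsub>A\<^esub> a)" if "a \<in> carrier A" for a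
    using XaX[OF that] that P.inv_solve_left'[of "\<alpha> (inv\<^bsub>A\<^esub> a)" X "\<alpha> a \<otimes>\<^bsub>?P\<^esub> X"] by simp
  have \<alpha>1: "\<alpha> \<one>\<^bsub>A\<^esub> = \<one>\<^bsub>?P\<^esub>"
    using \<alpha>m[of "\<one>\<^bsub>A\<^esub>" "\<one>\<^bsub>A\<^esub>"] P.l_cancel_one[of "\<alpha> \<one>\<^bsub>A\<^esub>" "\<alpha> \<one>\<^bsub>A\<^esub>"] by simp
  have \<alpha>i: "inv\<^bsub>?P\<^esub> (\<alpha> a) = \<alpha> (inv\<^bsub>A\<^esub> a)" if "a \<in> carrier A" for a
    using that \<alpha>m \<alpha>1 by (intro P.inv_equality) simp_all
  have Xi: "inv\<^bsub>?P\<^esub> X = X \<otimes>\<^bsub>?P\<^esub> \<alpha> (inv\<^bsub>A\<^esub> y)"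
  proof -
    have "X \<otimes>\<^bsub>?P\<^esub> (X \<otimes>\<^bsub>?P\<^esub> \<alpha> (inv\<^bsub>A\<^esub> y)) = \<one>\<^bsub>?P\<^esub>"
      using y by (simp add: P.m_assoc[symmetric] XX) (simp add: \<alpha>m \<alpha>1)
    then have "(X \<otimes>\<^bsub>?P\<^esub> \<alpha> (inv\<^bsub>A\<^esub> y)) \<otimes>\<^bsub>?P\<^esub> X = \<one>\<^bsub>?P\<^esub>"
      by (rule P.inv_comm) (use y in auto)
    then show ?thesis using y by (intro P.inv_equality) auto
  qed
  define K where "K = \<alpha> ` carrier A \<union> (\<lambda>a. X \<otimes>\<^bsub>?P\<^esub> \<alpha> a) ` carrier A"
  \<comment> \<open>\<open>K\<close> contains the identity and is stable under left multiplication by generators and their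
    inverses, so it is the whole group.\<close>
  have K\<alpha>: "\<alpha> b \<otimes>\<^bsub>?P\<^esub> k \<in> K" if b: "b \<in> carrier A" and k: "k \<in> K" for b k
  proof -
    have "\<alpha> b \<otimes>\<^bsub>?P\<^esub> (X \<otimes>\<^bsub>?P\<^esub> \<alpha> a) = X \<otimes>\<^bsub>?P\<^esub> \<alpha> (inv\<^bsub>A\<^esub> b \<otimes>\<^bsub>A\<^esub> a)" if "a \<in> carrier A" for a
      using that b by (simp add: P.m_assoc[symmetric] aX) (simp add: P.m_assoc \<alpha>m)
    then show ?thesis using k b by (auto simp: K_def \<alpha>m)
  qed
  have KX: "X \<otimes>\<^bsub>?P\<^esub> k \<in> K" if k: "k \<in> K" for k
  proof -
    have "X \<otimes>\<^bsub>?P\<^esub> (X \<otimes>\<^bsub>?P\<^esub> \<alpha> a) = \<alpha> (y \<otimes>\<^bsub>A\<^esub> a)" if "a \<in> carrier A" for a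
      using that y by (simp add: P.m_assoc[symmetric] XX) (simp add: \<alpha>m)
    then show ?thesis using k y by (auto simp: K_def)
  qed
  have K: "cl w \<in> K" if "w \<in> lists (gens \<times> UNIV)" for w
    using that
  proof (induction w)
    case Nil
    then show ?case using one \<alpha>1 by (auto simp: K_def)
  next
    case (Cons p w)
    obtain g b where p: "p = (g, b)" by (cases p)
    have eq: "cl (p # w) = (if b then cl [(g, True)] else inv\<^bsub>?P\<^esub> (cl [(g, True)])) \<otimes>\<^bsub>?P\<^esub> cl w"
      using Cons.hyps p cl_Cons by auto
    have w: "cl w \<in> carrier ?P" using Cons.hyps unfolding car by auto
    show ?case
    proof (cases g)
      case None
      have "inv\<^bsub>?P\<^esub> X \<otimes>\<^bsub>?P\<^esub> cl w = X \<otimes>\<^bsub>?P\<^esub> (\<alpha> (inv\<^bsub>A\<^esub> y) \<otimes>\<^bsub>?P\<^esub> cl w)"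
        using y w by (simp add: Xi P.m_assoc)
      then show ?thesis
        using eq None K\<alpha>[of "inv\<^bsub>A\<^esub> y" "cl w"] KX Cons.IH y by (auto simp: X_def[symmetric])
    next
      case (Some a)
      then have "a \<in> carrier A" using Cons.hyps p by auto
      then show ?thesis
        using eq Some K\<alpha> Cons.IH by (auto simp: \<alpha>_def[symmetric] \<alpha>i)
    qed
  qed
  have XA: "X \<otimes>\<^bsub>?P\<^esub> \<alpha> a = cl [(None, True), (Some a, True)]" if "a \<in> carrier A" for a
    using cl_Cons[of None "[(Some a, True)]" True] that by (simp add: X_def \<alpha>_def)
  show "?r `` {[(Some \<one>\<^bsub>A\<^esub>, True)]} = \<one>\<^bsub>Dic A y\<^esub>" using \<alpha>1 Dic by (simp add: \<alpha>_def cl_def)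
  assume "C \<in> carrier (Dic A y)"
  then have "C \<in> K" using K by (auto simp: Dic car)
  then show "\<exists>a\<in>carrier A. C = ?r `` {[(Some a, True)]} \<or> C = ?r `` {[(None, True), (Some a, True)]}"
    using XA by (auto simp: K_def \<alpha>_def cl_def)
qed

lemma (in group) group_exponent_gt_2:
  assumes "finite (carrier G)" "a \<in> carrier G" "a \<otimes> a \<noteq> \<one>"
  shows "group_exponent G > 2"
proof -
  let ?P = "\<lambda>n. n > 0 \<and> (\<forall>g\<in>carrier G. g [^] n = \<one>)"
  have "?P (order G)" using assms(1) by (simp add: pow_order_eq_1 order_gt_0_iff_finite)
  then have e: "?P (group_exponent G)" unfolding group_exponent_def by (rule LeastI)
  have "a \<noteq> \<one>" using assms by auto
  then have "group_exponent G \<noteq> 1" using e assms(2) by (metis nat_pow_eone)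
  moreover have "group_exponent G \<noteq> 2"
    using e assms(2,3) by (metis Suc_1 nat_pow_Suc nat_pow_eone One_nat_def)
  ultimately show ?thesis using e by linarith
qed

text \<open>By the universal property there is a homomorphism from the presented group that is the identity
  on \<open>H\<close> and sends the extra generator to \<open>x\<close>. It is onto because \<open>G = H \<union> xH\<close>, and injective on
  normal forms because \<open>x \<notin> H\<close>. The element \<open>x\<^sup>2\<close> has order two since \<open>x\<close> both
  centralises and inverts it.\<close>

lemma (in group) generalised_dicyclicI:
  assumes fin: "finite (carrier G)" and H: "subgroup H G"
    and comm: "\<And>a b. a \<in> H \<Longrightarrow> b \<in> H \<Longrightarrow> a \<otimes> b = b \<otimes> a"
    and a: "a \<in> H" "a \<otimes> a \<noteq> \<one>"
    and x: "x \<in> carrier G" "x \<notin> H" "x \<otimes> x \<in> H" "x \<otimes> x \<noteq> \<one>"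
    and inverts: "\<And>h. h \<in> H \<Longrightarrow> inv x \<otimes> h \<otimes> x = inv h"
    and cover: "\<And>r. r \<in> carrier G \<Longrightarrow> r \<notin> H \<Longrightarrow> inv x \<otimes> r \<in> H"
  shows "generalised_dicyclic G"
proof -
  define A :: "'a monoid" where "A = \<lparr>carrier = H, monoid.mult = (\<otimes>), one = \<one>\<rparr>"
  define y where "y = x \<otimes> x"
  interpret H: subgroup H G by (rule H)
  have A_simps [simp]: "carrier A = H" "\<And>u v. u \<otimes>\<^bsub>A\<^esub> v = u \<otimes> v" "\<one>\<^bsub>A\<^esub> = \<one>" by (auto simp: A_def)
  interpret A: comm_group A
    by (rule comm_groupI) (auto simp: m_assoc intro: comm intro!: bexI[of _ "inv _"])
  have invA: "inv\<^bsub>A\<^esub> h = inv h" if "h \<in> H" for h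
    using that by (intro A.inv_equality) auto
  have finA: "finite (carrier A)" using fin H.subset by (auto intro: finite_subset)
  have yH: "y \<in> H" and y1: "y \<noteq> \<one>" using x by (auto simp: y_def)
  have "inv y = inv x \<otimes> y \<otimes> x" using inverts[OF yH] by simp
  also have "\<dots> = y" using x by (simp add: y_def m_assoc[symmetric])
  finally have yy: "y \<otimes> y = \<one>" using yH by (metis H.mem_carrier r_inv)
  have "y [^]\<^bsub>A\<^esub> (2::nat) = \<one>\<^bsub>A\<^esub>" using yH yy by (simp add: numeral_2_eq_2)
  then have "A.ord y dvd 2" using A.pow_eq_id yH by auto
  moreover have "A.ord y \<noteq> 1" using A.ord_eq_1 yH y1 by auto
  ultimately have ord: "A.ord y = 2" by (metis dvd_1_iff_1 dvd_imp_le le_antisym not_less_eq_eq numeral_2_eq_2 One_nat_def zero_less_Suc A.ord_ge_1 finA yH A_simps(1))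
  then have even: "even (order A)" using A.ord_dvd_group_order[of y] yH by auto
  have exp: "group_exponent A > 2" using A.group_exponent_gt_2[OF finA, of a] a by simp
  define gens where "gens = Dic_gens A"
  define rels where "rels = Dic_rels A y"
  have Dic: "Dic A y = presented_group gens rels" by (simp add: Dic_eq gens_def rels_def)
  have A': "group A" ..
  have "y \<in> carrier A" using yH by simp
  note one = Dic_normal_form(1)[OF A' this, folded gens_def rels_def]
    and nf = Dic_normal_form(2)[OF A' this, folded gens_def rels_def]
  define \<phi> where "\<phi> g = (case g of None \<Rightarrow> x | Some a \<Rightarrow> a)" for g
  have \<phi>: "\<phi> \<in> gens \<rightarrow> carrier G" using x by (auto simp: \<phi>_def gens_def Dic_gens_def)
  have "word_eval \<phi> l = word_eval \<phi> r" if "(l, r) \<in> rels" for l r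
  proof -
    from that consider (mult) a b where "a \<in> H" "b \<in> H"
        "l = [(Some a, True), (Some b, True)]" "r = [(Some (a \<otimes> b), True)]"
      | (square) "l = [(None, True), (None, True)]" "r = [(Some y, True)]"
      | (conj) a where "a \<in> H"
        "l = [(None, False), (Some a, True), (None, True)]" "r = [(Some (inv a), True)]"
      unfolding rels_def Dic_rels_def using invA by auto
    then show ?thesis
    proof cases
      case conj
      then show ?thesis using inverts[of a] x by (simp add: \<phi>_def m_assoc)
    qed (use x in \<open>simp_all add: \<phi>_def y_def\<close>)
  qed
  then obtain h where h: "h \<in> hom (Dic A y) G"
    and hw: "\<And>w. w \<in> lists (gens \<times> UNIV) \<Longrightarrow> h (pres_rel gens rels `` {w}) = word_eval \<phi> w"
    using presented_group_hom[OF \<phi>, of rels] unfolding Dic by metis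
  have h1: "h (pres_rel gens rels `` {[(Some a, True)]}) = a" if "a \<in> H" for a
    using that by (subst hw) (auto simp: gens_def Dic_gens_def \<phi>_def)
  have h2: "h (pres_rel gens rels `` {[(None, True), (Some a, True)]}) = x \<otimes> a" if "a \<in> H" for a
    using that by (subst hw) (auto simp: gens_def Dic_gens_def \<phi>_def)
  have Dgrp: "group (Dic A y)" unfolding Dic by (rule group_presented_group)
  interpret D: group_hom "Dic A y" G h
    using h Dgrp by (simp add: group_hom_def group_hom_axioms_def is_group)
  have "kernel (Dic A y) G h = {\<one>\<^bsub>Dic A y\<^esub>}"
  proof (intro equalityI subsetI)
    fix C assume C: "C \<in> kernel (Dic A y) G h"
    then obtain a where a: "a \<in> H" "C = pres_rel gens rels `` {[(Some a, True)]}
        \<or> C = pres_rel gens rels `` {[(None, True), (Some a, True)]}"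
      using nf[of C] by (auto simp: kernel_def)
    have "x \<otimes> a \<noteq> \<one>" using a x by (metis H.m_inv_closed H.mem_carrier inv_equality inv_inv)
    then have "a = \<one>" "C = pres_rel gens rels `` {[(Some a, True)]}"
      using a C h1 h2 by (auto simp: kernel_def)
    then show "C \<in> {\<one>\<^bsub>Dic A y\<^esub>}" using one by simp
  next
    fix C assume "C \<in> {\<one>\<^bsub>Dic A y\<^esub>}"
    then show "C \<in> kernel (Dic A y) G h" by (simp add: kernel_def)
  qed
  then have inj: "inj_on h (carrier (Dic A y))" by (rule D.trivial_ker_imp_inj)
  have car: "pres_rel gens rels `` {w} \<in> carrier (Dic A y)" if "w \<in> lists (gens \<times> UNIV)" for w
    using that by (auto simp: Dic presented_group_def quotient_def)
  have "r \<in> h ` carrier (Dic A y)" if r: "r \<in> carrier G" for r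
  proof (cases "r \<in> H")
    case True
    then show ?thesis using h1[OF True] car[of "[(Some r, True)]"]
      by (auto simp: gens_def Dic_gens_def intro!: rev_image_eqI)
  next
    case False
    then have a: "inv x \<otimes> r \<in> H" using cover r by blast
    have "h (pres_rel gens rels `` {[(None, True), (Some (inv x \<otimes> r), True)]}) = r"
      using h2[OF a] r x by (simp add: m_assoc[symmetric])
    then show ?thesis using a car[of "[(None, True), (Some (inv x \<otimes> r), True)]"]
      by (auto simp: gens_def Dic_gens_def intro!: rev_image_eqI)
  qed
  then have "h ` carrier (Dic A y) = carrier G" using D.hom_closed by auto
  then have "h \<in> iso (Dic A y) G" using h inj by (simp add: iso_def bij_betw_def)
  then have "Dic A y \<cong> G" by (auto simp: is_iso_def)
  then have "G \<cong> Dic A y" by (rule group.iso_sym[OF Dgrp])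
  then show ?thesis
    unfolding generalised_dicyclic_def
    using A.comm_group_axioms finA even exp yH ord by (intro exI[of _ A] exI[of _ y]) simp
qed

section \<open>Centralising and inverting\<close>

lemma (in group) inv_cancel:
  assumes "x \<in> carrier G" "z \<in> carrier G"
  shows "inv x \<otimes> (x \<otimes> z) = z" "x \<otimes> (inv x \<otimes> z) = z"
  using assms by (simp_all add: m_assoc[symmetric])

lemmas (in group) word_simps = m_assoc inv_mult_group inv_cancel

definition (in group) cent :: "'a \<Rightarrow> 'a set" where
  "cent f = {r \<in> carrier G. r \<otimes> f = f \<otimes> r}"

definition (in group) cent_inv :: "'a \<Rightarrow> 'a set" where
  "cent_inv f = {r \<in> carrier G. r \<otimes> f = f \<otimes> r \<or> r \<otimes> f = inv f \<otimes> r}"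

definition (in group) centre :: "'a set" where
  "centre = {c \<in> carrier G. \<forall>r\<in>carrier G. c \<otimes> r = r \<otimes> c}"

text \<open>Multiplying an equation on both sides and cancelling with \<open>word_simps\<close> proves the identities
  between conjugates below.\<close>

lemma (in group) mult_left_eqD:
  assumes "a \<otimes> b = c \<otimes> d" "p \<in> carrier G" "q \<in> carrier G"
    "a \<in> carrier G" "b \<in> carrier G" "c \<in> carrier G" "d \<in> carrier G"
  shows "p \<otimes> (a \<otimes> (b \<otimes> q)) = p \<otimes> (c \<otimes> (d \<otimes> q))"
  using assms by (metis m_assoc)

lemma (in group) inverts_inv:
  assumes "r \<in> carrier G" "f \<in> carrier G" "r \<otimes> f = inv f \<otimes> r"
  shows "r \<otimes> inv f = f \<otimes> r" "inv r \<otimes> f = inv f \<otimes> inv r"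
    "inv r \<otimes> inv f = f \<otimes> inv r"
proof -
  show 1: "r \<otimes> inv f = f \<otimes> r"
    using mult_left_eqD[OF assms(3), of f "inv f"] assms(1,2) by (simp add: word_simps)
  show "inv r \<otimes> f = inv f \<otimes> inv r"
    using mult_left_eqD[OF 1, of "inv r" "inv r"] assms(1,2) by (simp add: word_simps)
  show "inv r \<otimes> inv f = f \<otimes> inv r"
    using mult_left_eqD[OF assms(3), of "inv r" "inv r"] assms(1,2) by (simp add: word_simps)
qed

lemma (in group) commutes_inv:
  assumes "r \<in> carrier G" "f \<in> carrier G" "r \<otimes> f = f \<otimes> r"
  shows "inv r \<otimes> f = f \<otimes> inv r" "r \<otimes> inv f = inv f \<otimes> r"
proof -
  show "inv r \<otimes> f = f \<otimes> inv r"
    using mult_left_eqD[OF assms(3), of "inv r" "inv r"] assms(1,2) by (simp add: word_simps)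
  show "r \<otimes> inv f = inv f \<otimes> r"
    using mult_left_eqD[OF assms(3), of "inv f" "inv f"] assms(1,2) by (simp add: word_simps)
qed

lemma (in group) commutes_mult:
  assumes "r \<in> carrier G" "s \<in> carrier G" "f \<in> carrier G"
    "r \<otimes> f = f \<otimes> r" "s \<otimes> f = f \<otimes> s"
  shows "r \<otimes> s \<otimes> f = f \<otimes> (r \<otimes> s)"
proof -
  have "r \<otimes> s \<otimes> f = r \<otimes> f \<otimes> s" using assms(1-3,5) by (simp add: m_assoc)
  then show ?thesis using assms(1-4) by (simp add: m_assoc)
qed

lemma (in group) subgroup_cent:
  assumes f: "f \<in> carrier G"
  shows "subgroup (cent f) G"
proof (rule subgroupI)
  fix a assume "a \<in> cent f"
  then show "inv a \<in> cent f" using commutes_inv(1)[of a f] f by (simp add: cent_def)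
next
  fix a b assume "a \<in> cent f" "b \<in> cent f"
  then show "a \<otimes> b \<in> cent f" using commutes_mult[of a b f] f by (simp add: cent_def)
qed (use f in \<open>auto simp: cent_def\<close>)

lemma (in group) subgroup_centre: "subgroup centre G"
proof (rule subgroupI)
  fix a assume "a \<in> centre"
  then show "inv a \<in> centre" unfolding centre_def by (blast intro: commutes_inv(1))
next
  fix a b assume "a \<in> centre" "b \<in> centre"
  then show "a \<otimes> b \<in> centre" unfolding centre_def by (blast intro: commutes_mult)
qed (auto simp: centre_def)

lemma (in group) subgroup_cent_inv:
  assumes f: "f \<in> carrier G"
  shows "subgroup (cent_inv f) G"
proof (rule subgroupI)
  fix a assume "a \<in> cent_inv f"
  then consider "a \<in> carrier G" "a \<otimes> f = f \<otimes> a" | "a \<in> carrier G" "a \<otimes> f = inv f \<otimes> a"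
    by (auto simp: cent_inv_def)
  then show "inv a \<in> cent_inv f"
    by cases (use f commutes_inv(1)[of a f] inverts_inv(2)[of a f] in \<open>simp_all add: cent_inv_def\<close>)
next
  fix a b assume ab: "a \<in> cent_inv f" "b \<in> cent_inv f"
  then have c: "a \<in> carrier G" "b \<in> carrier G" by (auto simp: cent_inv_def)
  consider "a \<otimes> f = f \<otimes> a" | "a \<otimes> f = inv f \<otimes> a" using ab by (auto simp: cent_inv_def)
  then have a: "a \<otimes> f \<otimes> b = f \<otimes> (a \<otimes> b) \<and> a \<otimes> inv f \<otimes> b = inv f \<otimes> (a \<otimes> b)
    \<or> a \<otimes> f \<otimes> b = inv f \<otimes> (a \<otimes> b) \<and> a \<otimes> inv f \<otimes> b = f \<otimes> (a \<otimes> b)"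
  proof cases
    case 1
    then show ?thesis using commutes_inv(2)[of a f] c f by (simp add: m_assoc)
  next
    case 2
    then show ?thesis using inverts_inv(1)[of a f] c f by (simp add: m_assoc)
  qed
  consider "b \<otimes> f = f \<otimes> b" | "b \<otimes> f = inv f \<otimes> b" using ab by (auto simp: cent_inv_def)
  then have "a \<otimes> b \<otimes> f = a \<otimes> f \<otimes> b \<or> a \<otimes> b \<otimes> f = a \<otimes> inv f \<otimes> b"
    by cases (use c f in \<open>simp_all add: m_assoc\<close>)
  then have "a \<otimes> b \<otimes> f = f \<otimes> (a \<otimes> b) \<or> a \<otimes> b \<otimes> f = inv f \<otimes> (a \<otimes> b)"
    using a by argo
  then show "a \<otimes> b \<in> cent_inv f" using c by (auto simp: cent_inv_def)
qed (use f in \<open>auto simp: cent_inv_def\<close>)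

lemma (in group) inverts_twice:
  assumes "r \<in> carrier G" "s \<in> carrier G" "f \<in> carrier G"
    "r \<otimes> f = inv f \<otimes> r" "s \<otimes> f = inv f \<otimes> s"
  shows "inv r \<otimes> s \<in> cent f" "r \<otimes> s \<in> cent f"
proof -
  have "r \<otimes> s \<otimes> f = f \<otimes> (r \<otimes> s)" if "r \<in> carrier G" "r \<otimes> f = inv f \<otimes> r" for r
  proof -
    have "r \<otimes> s \<otimes> f = r \<otimes> inv f \<otimes> s" using that assms by (simp add: m_assoc)
    also have "\<dots> = f \<otimes> (r \<otimes> s)" using that assms inverts_inv(1)[of r f] by (simp add: m_assoc)
    finally show ?thesis .
  qed
  from this[of r] this[of "inv r"] show "inv r \<otimes> s \<in> cent f" "r \<otimes> s \<in> cent f"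
    using assms inverts_inv(2)[of r f] by (auto simp: cent_def)
qed

lemma (in group) mult_mem_cent_iff:
  assumes f: "f \<in> carrier G" "cent_inv f = carrier G" and s: "s \<in> carrier G" and t: "t \<in> carrier G"
  shows "s \<otimes> t \<in> cent f \<longleftrightarrow> (s \<in> cent f \<longleftrightarrow> t \<in> cent f)"
proof -
  interpret C: subgroup "cent f" G using f by (intro subgroup_cent)
  have inv: "r \<otimes> f = inv f \<otimes> r" if "r \<in> carrier G" "r \<notin> cent f" for r
    using that f(2) unfolding cent_inv_def cent_def by blast
  have "s = s \<otimes> t \<otimes> inv t" "t = inv s \<otimes> (s \<otimes> t)" using s t by (simp_all add: word_simps)
  then show ?thesis
    using C.m_closed C.m_inv_closed inverts_twice(2)[OF s t f(1)] inv s t by metis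
qed

lemma (in group) card_le_translate:
  assumes "finite T" "S \<subseteq> carrier G" "a \<in> carrier G" "\<And>s. s \<in> S \<Longrightarrow> a \<otimes> s \<in> T"
  shows "card S \<le> card T"
proof (rule card_inj_on_le)
  show "inj_on ((\<otimes>) a) S" using assms(2,3) by (auto simp: inj_on_def subset_iff)
qed (use assms in auto)

text \<open>Two elements inverting \<open>f\<close> differ by an element centralising \<open>f\<close>; hence, when everything
  centralises or inverts \<open>f\<close>, the centraliser has index at most two.\<close>

lemma (in group) card_cent_ge_half:
  assumes "finite (carrier G)" "f \<in> carrier G" "cent_inv f = carrier G"
  shows "order G \<le> 2 * card (cent f)"
proof -
  have sub: "cent f \<subseteq> carrier G" by (auto simp: cent_def)
  have fin: "finite (cent f)" using sub assms(1) by (rule finite_subset)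
  have "card (carrier G - cent f) \<le> card (cent f)"
  proof (cases "carrier G = cent f")
    case False
    then obtain r where r: "r \<in> carrier G" "r \<notin> cent f" using sub by blast
    have *: "s \<otimes> f = inv f \<otimes> s" if "s \<in> carrier G" "s \<notin> cent f" for s
      using that assms(3) by (auto simp: cent_def cent_inv_def)
    show ?thesis
      by (rule card_le_translate[of _ _ "inv r"]) (use fin r * assms inverts_twice in auto)
  qed simp
  then show ?thesis using card_Diff_subset[OF fin sub] card_mono[OF assms(1) sub]
    by (simp add: order_def)
qed

lemma (in group) card_outside_proper_subgroup:
  assumes fin: "finite (carrier G)" and H: "subgroup H G" "H \<noteq> carrier G"
  shows "order G \<le> 2 * card (carrier G - H)"
proof -
  interpret H: subgroup H G by (rule H)
  obtain r where r: "r \<in> carrier G" "r \<notin> H" using H.subset H(2) by blast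
  have "r \<otimes> h \<notin> H" if "h \<in> H" for h
    using r that H.m_closed[of "r \<otimes> h" "inv h"] by (auto simp: m_assoc)
  then have "card H \<le> card (carrier G - H)"
    using r H.subset fin by (intro card_le_translate[of _ _ r]) auto
  moreover have "card (carrier G - H) = card (carrier G) - card H" "card H \<le> card (carrier G)"
    using fin H.subset by (auto intro: card_Diff_subset card_mono finite_subset)
  ultimately show ?thesis by (auto simp: order_def)
qed

section \<open>Groups in which almost everything is fixed or inverted\<close>

text \<open>What remains of a point stabiliser \<open>G\<^sub>1\<close> once the permutations are forgotten: \<open>F\<close> is the set
  of its fixed points and \<open>X\<close> consists of the elements whose \<open>G\<^sub>1\<close>-orbit is contained in
  \<open>{x, x\<^sup>-\<^sup>1}\<close>. The assumption \<open>prod\<close> records that the orbit of a product is contained in the product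
  of the orbits, applied to a permutation moving \<open>y \<otimes> x\<close> to its inverse. In a generalised dicyclic
  group over \<open>A\<close>, the map fixing \<open>A\<close> and inverting everything else gives the example \<open>F = A\<close> with \<open>X\<close>
  the whole group.\<close>

locale dense_inverted = group G for G (structure) +
  fixes F X
  assumes fin: "finite (carrier G)"
    and F: "subgroup F G" and F_proper: "F \<noteq> carrier G"
    and F_sub: "F \<subseteq> X" and X_sub: "X \<subseteq> carrier G"
    and inv_X: "x \<in> X \<Longrightarrow> inv x \<in> X"
    and moved: "x \<in> X \<Longrightarrow> x \<notin> F \<Longrightarrow> inv x \<noteq> x"
    and prod: "\<lbrakk>y \<in> X; x \<in> X; y \<otimes> x \<in> X; y \<otimes> x \<notin> F\<rbrakk> \<Longrightarrow>
      \<exists>y'\<in>{y, inv y}. \<exists>x'\<in>{x, inv x}. inv (y \<otimes> x) = y' \<otimes> x' \<and> (x \<in> F \<longrightarrow> x' = x)"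
    and dense: "24 * card (carrier G - X) < order G"
begin

lemma XG: "x \<in> X \<Longrightarrow> x \<in> carrier G" using X_sub by auto

lemma FG: "x \<in> F \<Longrightarrow> x \<in> carrier G" using F_sub XG by auto

lemma square_ne_one: "x \<in> X \<Longrightarrow> x \<notin> F \<Longrightarrow> x \<otimes> x \<noteq> \<one>"
  using moved inv_equality XG by blast

text \<open>The counting principle behind every choice of a generic element: each condition
  \<open>y \<otimes> a \<in> X\<close> excludes fewer than a twenty-fourth of all \<open>y\<close>.\<close>

lemma ex_good:
  assumes M: "finite M" "M \<noteq> {}" "M \<subseteq> carrier G" and S: "S \<subseteq> carrier G"
    and le: "card M * order G \<le> 24 * card S"
  shows "\<exists>y\<in>S. \<forall>a\<in>M. y \<otimes> a \<in> X"
proof (rule ccontr)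
  assume "\<not> ?thesis"
  then have sub: "S \<subseteq> (\<Union>a\<in>M. {y \<in> carrier G. y \<otimes> a \<notin> X})" using S by auto
  have "card {y \<in> carrier G. y \<otimes> a \<notin> X} \<le> card (carrier G - X)" if "a \<in> M" for a
  proof (rule card_inj_on_le)
    show "inj_on (\<lambda>y. y \<otimes> a) {y \<in> carrier G. y \<otimes> a \<notin> X}"
      using M that by (auto simp: inj_on_def subset_iff)
  qed (use M fin that in auto)
  then have bound: "(\<Sum>a\<in>M. card {y \<in> carrier G. y \<otimes> a \<notin> X}) \<le> card M * card (carrier G - X)"
    using sum_bounded_above[of M "\<lambda>a. card {y \<in> carrier G. y \<otimes> a \<notin> X}" "card (carrier G - X)"] by simp
  have "card S \<le> card (\<Union>a\<in>M. {y \<in> carrier G. y \<otimes> a \<notin> X})"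
    by (rule card_mono[OF _ sub]) (use fin M in auto)
  also have "\<dots> \<le> (\<Sum>a\<in>M. card {y \<in> carrier G. y \<otimes> a \<notin> X})" by (rule card_UN_le[OF M(1)])
  also note bound
  finally have "card S \<le> card M * card (carrier G - X)" .
  then have "24 * card S \<le> card M * (24 * card (carrier G - X))" by simp
  also have "\<dots> < card M * order G" using dense M by (simp add: card_gt_0_iff)
  finally show False using le by simp
qed

text \<open>A proper subgroup misses at least half of the group, so up to twelve conditions \<open>y \<otimes> a \<in> X\<close>
  can be met outside it. Thus a property that defines a subgroup need only be checked for generic
  elements.\<close>

lemma subgroup_eq_carrier:
  assumes H: "subgroup H G" and M: "finite M" "M \<noteq> {}" "M \<subseteq> carrier G" "card M \<le> 12"
    and good: "\<And>y. \<lbrakk>y \<in> carrier G; \<forall>a\<in>M. y \<otimes> a \<in> X\<rbrakk> \<Longrightarrow> y \<in> H"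
  shows "H = carrier G"
proof (rule ccontr)
  assume "H \<noteq> carrier G"
  then have "order G \<le> 2 * card (carrier G - H)" using card_outside_proper_subgroup[OF fin H] by simp
  then have "card M * order G \<le> 24 * card (carrier G - H)"
    using mult_le_mono[OF M(4)] by fastforce
  then obtain y where "y \<in> carrier G - H" "\<forall>a\<in>M. y \<otimes> a \<in> X" using ex_good[OF M(1-3), of "carrier G - H"] by blast
  then show False using good by auto
qed

lemma card_doubleton_le: "card {a, b} \<le> 2"
  by (simp add: card_insert_if)

lemma ex_moved: "\<exists>x\<in>X. x \<notin> F"
proof (rule ccontr)
  assume "\<not> ?thesis"
  then have "F = carrier G"
    by (intro subgroup_eq_carrier[of F "{\<one>}"]) (auto simp: F)
  then show False using F_proper by simp
qed

text \<open>Since \<open>f\<close> is fixed and \<open>y \<otimes> f\<close> is moved, \<open>(yf)\<^sup>-\<^sup>1\<close> can only be \<open>y\<^sup>-\<^sup>1f\<close>.\<close>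

lemma moved_inverts_F:
  assumes f: "f \<in> F" and y: "y \<in> X" "y \<notin> F" and yf: "y \<otimes> f \<in> X"
  shows "y \<otimes> f = inv f \<otimes> y"
proof -
  have c: "f \<in> carrier G" "y \<in> carrier G" using f y FG XG by auto
  have fX: "f \<in> X" using f F_sub by auto
  have nF: "y \<otimes> f \<notin> F"
  proof
    assume "y \<otimes> f \<in> F"
    then have "y \<otimes> f \<otimes> inv f \<in> F" using f F by (simp add: subgroup.m_closed subgroup.m_inv_closed)
    then show False using y c by (simp add: m_assoc)
  qed
  obtain y' x' where y': "y' \<in> {y, inv y}" "inv (y \<otimes> f) = y' \<otimes> x'" "f \<in> F \<longrightarrow> x' = f"
    using prod[OF y(1) fX yf nF] by blast
  then have "y' = inv y" "x' = f" using moved[OF yf nF] f by auto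
  then have "inv f \<otimes> inv y = inv y \<otimes> f" using y' c by (simp add: inv_mult_group)
  from mult_left_eqD[OF this, of y y] show ?thesis
    using c inverts_inv[of y "inv f"] by (simp add: word_simps)
qed

text \<open>A single \<open>y\<close> inverts \<open>f\<close>, \<open>g\<close> and \<open>f \<otimes> g\<close>, and inversion is a homomorphism only on commuting
  elements.\<close>

lemma F_commutes:
  assumes f: "f \<in> F" "g \<in> F"
  shows "f \<otimes> g = g \<otimes> f"
proof -
  have c: "f \<in> carrier G" "g \<in> carrier G" using f FG by auto
  have "card {\<one>, f, g, f \<otimes> g} \<le> 4" by (simp add: card_insert_if)
  then have "card {\<one>, f, g, f \<otimes> g} * order G \<le> 24 * card (carrier G - F)"
    using card_outside_proper_subgroup[OF fin F F_proper]
      mult_le_mono[of "card {\<one>, f, g, f \<otimes> g}" 4 "order G" "2 * card (carrier G - F)"] by linarith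
  then obtain y where y: "y \<in> carrier G" "y \<notin> F" "\<forall>a\<in>{\<one>, f, g, f \<otimes> g}. y \<otimes> a \<in> X"
    using ex_good[of "{\<one>, f, g, f \<otimes> g}" "carrier G - F"] c by blast
  then have yX: "y \<in> X" by simp
  have fg: "f \<otimes> g \<in> F" using f F by (simp add: subgroup.m_closed)
  have "y \<otimes> f = inv f \<otimes> y" "y \<otimes> g = inv g \<otimes> y" "y \<otimes> (f \<otimes> g) = inv (f \<otimes> g) \<otimes> y"
    using moved_inverts_F[OF _ yX y(2)] f fg y(3) by auto
  then have "inv f \<otimes> inv g \<otimes> y = inv (f \<otimes> g) \<otimes> y" using c y(1) by (metis inv_closed m_assoc)
  then have "inv f \<otimes> inv g = inv (f \<otimes> g)" using c y(1) by simp
  then have "inv (inv f \<otimes> inv g) = f \<otimes> g" using c by simp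
  then show ?thesis using c by (simp add: inv_mult_group)
qed

lemma cent_inv_F:
  assumes f: "f \<in> F"
  shows "cent_inv f = carrier G"
proof (rule subgroup_eq_carrier[of _ "{\<one>, f}"])
  fix y assume y: "y \<in> carrier G" "\<forall>a\<in>{\<one>, f}. y \<otimes> a \<in> X"
  then show "y \<in> cent_inv f"
    using F_commutes[of y f] moved_inverts_F[of f y] f FG by (cases "y \<in> F") (auto simp: cent_inv_def)
qed (use f FG subgroup_cent_inv card_doubleton_le[of \<one> f] in auto)

text \<open>Elements of \<open>X\<close> outside \<open>F\<close> generically invert \<open>f\<close>, so few of them can centralise it. But if
  \<^term>\<open>cent f\<close> were larger than \<open>F\<close>, then at least half of it, a quarter of the group, would lie
  outside \<open>F\<close>.\<close>

lemma cent_eq_F: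
  assumes f: "f \<in> F" "f \<otimes> f \<noteq> \<one>"
  shows "cent f = F"
proof (rule ccontr)
  have fc: "f \<in> carrier G" using f FG by auto
  have sub: "F \<subseteq> cent f" using F_commutes f FG by (auto simp: cent_def)
  assume "cent f \<noteq> F"
  then obtain r where r: "r \<in> cent f" "r \<notin> F" using sub by blast
  let ?S = "cent f - F"
  have cG: "cent f \<subseteq> carrier G" by (auto simp: cent_def)
  have finc: "finite (cent f)" using cG fin by (rule finite_subset)
  have "r \<otimes> h \<in> ?S" if h: "h \<in> F" for h
  proof -
    have "r \<otimes> h \<notin> F"
    proof
      assume "r \<otimes> h \<in> F"
      then have "r \<otimes> h \<otimes> inv h \<in> F" using h F by (simp add: subgroup.m_closed subgroup.m_inv_closed)
      then show False using r cG h FG[OF h] by (auto simp: m_assoc)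
    qed
    then show ?thesis using r sub h subgroup_cent[OF fc] by (auto intro: subgroup.m_closed)
  qed
  then have "card F \<le> card ?S"
    using finc r cG FG by (intro card_le_translate[of _ _ r]) auto
  moreover have "card (cent f) = card F + card ?S"
    using finc sub by (metis card_Diff_subset card_mono finite_subset le_add_diff_inverse)
  ultimately have "order G \<le> 4 * card ?S"
    using card_cent_ge_half[OF fin fc cent_inv_F[OF f(1)]] by linarith
  then have "card {\<one>, f} * order G \<le> 24 * card ?S"
    using mult_le_mono[OF card_doubleton_le[of \<one> f], of "order G" "4 * card ?S"] by linarith
  then obtain y where y: "y \<in> ?S" "\<forall>a\<in>{\<one>, f}. y \<otimes> a \<in> X"
    using ex_good[of "{\<one>, f}" ?S] fc cG by blast
  then have yc: "y \<in> carrier G" using cG by auto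
  then have "y \<otimes> f = inv f \<otimes> y" using moved_inverts_F[OF f(1), of y] y by auto
  then have "f \<otimes> y = inv f \<otimes> y" using y by (simp add: cent_def)
  then have "f = inv f" using fc yc by simp
  then show False using f(2) fc by (metis r_inv)
qed

text \<open>By \<open>cent_eq_F\<close> the subgroup \<open>F\<close> has index two and is inverted by everything outside it.
  An element of \<open>X\<close> outside \<open>F\<close> is not its own inverse, which excludes the generalised dihedral
  groups.\<close>

lemma dicyclic_of_F_exponent_gt_2:
  assumes f: "f \<in> F" "f \<otimes> f \<noteq> \<one>"
  shows "generalised_dicyclic G"
proof -
  have fc: "f \<in> carrier G" using f FG by auto
  have inv_out: "r \<otimes> h = inv h \<otimes> r" if r: "r \<in> carrier G" "r \<notin> F" and h: "h \<in> F" for r h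
  proof (cases "h \<otimes> h = \<one>")
    case True
    then have "inv h = h" using FG[OF h] by (simp add: inv_equality)
    then show ?thesis using cent_inv_F[OF h] r by (auto simp: cent_inv_def)
  next
    case False
    then show ?thesis using cent_inv_F[OF h] cent_eq_F[OF h False] r by (auto simp: cent_inv_def cent_def)
  qed
  obtain x where x: "x \<in> X" "x \<notin> F" using ex_moved by blast
  have xc: "x \<in> carrier G" using x XG by auto
  show ?thesis
  proof (rule generalised_dicyclicI[OF fin F F_commutes f xc x(2)])
    show "x \<otimes> x \<in> F" "x \<otimes> x \<noteq> \<one>"
      using inverts_twice(2)[OF xc xc fc] inv_out[OF xc x(2) f(1)] cent_eq_F[OF f] square_ne_one x by auto
    show "inv x \<otimes> r \<in> F" if "r \<in> carrier G" "r \<notin> F" for r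
      using inverts_twice(1)[OF xc that(1) fc] inv_out[OF xc x(2) f(1)] inv_out[OF that f(1)] cent_eq_F[OF f]
      by simp
    show "inv x \<otimes> h \<otimes> x = inv h" if h: "h \<in> F" for h
      using inverts_inv(2)[OF xc FG[OF h] inv_out[OF xc x(2) h]] xc FG[OF h] by (simp add: m_assoc)
  qed
qed

end

section \<open>The non-abelian case with central fixed points\<close>

text \<open>If \<open>F\<close> has exponent at most two, it is central, and the argument turns to the elements of \<open>X\<close>
  that are moved. The outcome is that \<open>G\<close> is the product of the quaternion group with an elementary
  abelian 2-group, which is generalised dicyclic.\<close>

locale dense_inverted_central = dense_inverted +
  assumes F_square: "f \<in> F \<Longrightarrow> f \<otimes> f = \<one>"
    and not_abelian: "centre \<noteq> carrier G"
begin

lemma centre_carrier: "c \<in> centre \<Longrightarrow> c \<in> carrier G"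
  by (simp add: centre_def)

lemma F_sub_centre: "F \<subseteq> centre"
proof
  fix f assume f: "f \<in> F"
  then have "inv f = f" using F_square FG by (simp add: inv_equality)
  then have "r \<otimes> f = f \<otimes> r" if "r \<in> cent_inv f" for r using that by (auto simp: cent_inv_def)
  then show "f \<in> centre" using cent_inv_F[OF f] FG[OF f] by (simp add: centre_def)
qed

text \<open>If \<open>y \<otimes> x\<close> is moved, its inverse \<open>x\<^sup>-\<^sup>1y\<^sup>-\<^sup>1\<close> is one of \<open>yx\<^sup>-\<^sup>1\<close>, \<open>y\<^sup>-\<^sup>1x\<close>, \<open>y\<^sup>-\<^sup>1x\<^sup>-\<^sup>1\<close>, and each of
  these equations is one of the three alternatives. If \<open>y \<otimes> x\<close> is fixed, it is central.\<close>

lemma commute_or_invert: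
  assumes y: "y \<in> X" and x: "x \<in> X" and yx: "y \<otimes> x \<in> X"
  shows "y \<otimes> x = x \<otimes> y \<or> y \<otimes> x = inv x \<otimes> y \<or> x \<otimes> y = inv y \<otimes> x"
proof (cases "y \<otimes> x \<in> F")
  case True
  have c: "y \<in> carrier G" "x \<in> carrier G" using y x XG by auto
  have "(y \<otimes> x) \<otimes> x = x \<otimes> (y \<otimes> x)" using True F_sub_centre c by (auto simp: centre_def)
  then have "(y \<otimes> x) \<otimes> x = (x \<otimes> y) \<otimes> x" using c by (simp add: m_assoc)
  then show ?thesis using c by simp
next
  case False
  have c: "y \<in> carrier G" "x \<in> carrier G" using y x XG by auto
  obtain y' x' where p: "y' \<in> {y, inv y}" "x' \<in> {x, inv x}" "inv (y \<otimes> x) = y' \<otimes> x'"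
    using prod[OF y x yx False] by blast
  have e: "inv x \<otimes> inv y = y' \<otimes> x'" using p(3) c by (simp add: inv_mult_group)
  have "\<not> (y' = y \<and> x' = x)" using moved[OF yx False] p(3) by auto
  then consider "y' = y" "x' = inv x" | "y' = inv y" "x' = x" | "y' = inv y" "x' = inv x"
    using p(1,2) by blast
  then show ?thesis
  proof cases
    case 1
    then have "inv x \<otimes> inv y = y \<otimes> inv x" using e by simp
    from mult_left_eqD[OF this, of "inv y" x] have "inv y \<otimes> (inv x \<otimes> (inv y \<otimes> x)) = \<one>"
      using c by (simp add: word_simps)
    then have "x \<otimes> (y \<otimes> (inv y \<otimes> (inv x \<otimes> (inv y \<otimes> x)))) = x \<otimes> y" using c by simp
    then show ?thesis using c by (simp add: word_simps)
  next
    case 2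
    then have "inv x \<otimes> inv y = inv y \<otimes> x" using e by simp
    from mult_left_eqD[OF this, of y y] have "y \<otimes> (inv x \<otimes> \<one>) = x \<otimes> y"
      using c by (simp add: word_simps)
    then have "inv x \<otimes> (y \<otimes> inv x) \<otimes> x = inv x \<otimes> (x \<otimes> y) \<otimes> x" using c by simp
    then show ?thesis using c by (simp add: word_simps)
  next
    case 3
    then have "inv x \<otimes> inv y = inv y \<otimes> inv x" using e by simp
    from mult_left_eqD[OF this, of "y \<otimes> x" "x \<otimes> y"] show ?thesis
      using c by (simp add: word_simps)
  qed
qed

text \<open>The pair \<open>(y\<^sup>-\<^sup>1, yx)\<close> has product \<open>x\<close> and so satisfies the hypotheses of \<open>commute_or_invert\<close> as
  well; comparing what it says with what is known about \<open>(y, x)\<close> determines the squares.\<close>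

lemma square_eq_if_inverts:
  assumes y: "y \<in> X" and x: "x \<in> X" and yx: "y \<otimes> x \<in> X"
    and nc: "y \<otimes> x \<noteq> x \<otimes> y" and i: "y \<otimes> x = inv x \<otimes> y"
  shows "x \<otimes> x = y \<otimes> y"
proof -
  have c: "y \<in> carrier G" "x \<in> carrier G" using y x XG by auto
  have p: "inv y \<otimes> (y \<otimes> x) = x" using c by (simp add: word_simps)
  have i2: "x \<otimes> y = y \<otimes> inv x" using inverts_inv(1)[OF c i] by simp
  consider "inv y \<otimes> (y \<otimes> x) = (y \<otimes> x) \<otimes> inv y"
    | "inv y \<otimes> (y \<otimes> x) = inv (y \<otimes> x) \<otimes> inv y"
    | "(y \<otimes> x) \<otimes> inv y = inv (inv y) \<otimes> (y \<otimes> x)"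
    using commute_or_invert[of "inv y" "y \<otimes> x"] inv_X[OF y] yx p x by auto
  then show ?thesis
  proof cases
    case 1
    then have "x \<otimes> y = (y \<otimes> x) \<otimes> inv y \<otimes> y" using p by simp
    then show ?thesis using nc c by (simp add: word_simps)
  next
    case 2
    then have "x = inv x \<otimes> (inv y \<otimes> inv y)" using p c by (simp add: word_simps)
    then have "x \<otimes> x = x \<otimes> (inv x \<otimes> (inv y \<otimes> inv y))" by simp
    then have xx: "x \<otimes> x = inv (y \<otimes> y)" using c by (simp add: word_simps)
    \<comment> \<open>\<open>y\<close> inverts \<open>x\<^sup>2 = y\<^sup>-\<^sup>2\<close>, with which it commutes.\<close>
    have "y \<otimes> (x \<otimes> x) = inv (x \<otimes> x) \<otimes> y"
    proof -
      have "y \<otimes> (x \<otimes> x) = y \<otimes> x \<otimes> x" using c by (simp add: m_assoc)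
      also have "\<dots> = inv x \<otimes> (y \<otimes> x)" using c i by (simp add: m_assoc)
      also have "\<dots> = inv (x \<otimes> x) \<otimes> y" using c i by (simp add: word_simps)
      finally show ?thesis .
    qed
    then have "y \<otimes> inv (y \<otimes> y) = (y \<otimes> y) \<otimes> y" using xx c by simp
    then have "inv y = y \<otimes> (y \<otimes> y)" using c by (simp add: word_simps)
    then have "inv y \<otimes> inv y = y \<otimes> (y \<otimes> y) \<otimes> inv y" by simp
    then show ?thesis using xx c by (simp add: word_simps)
  next
    case 3
    then have "(y \<otimes> x) \<otimes> inv y \<otimes> y = y \<otimes> (y \<otimes> x) \<otimes> y" using c by simp
    then have "y \<otimes> x = y \<otimes> (y \<otimes> (x \<otimes> y))" using c by (simp add: word_simps)
    then have "x = y \<otimes> (x \<otimes> y)" using c by simp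
    also have "\<dots> = y \<otimes> (y \<otimes> inv x)" using i2 by simp
    finally have "x \<otimes> x = y \<otimes> (y \<otimes> inv x) \<otimes> x" by simp
    then show ?thesis using c by (simp add: word_simps)
  qed
qed

text \<open>The case in which \<open>x\<close> inverts \<open>y\<close> reduces to the other one by passing to the pair
  \<open>(x\<^sup>-\<^sup>1, y\<^sup>-\<^sup>1)\<close>, whose product is \<open>(yx)\<^sup>-\<^sup>1\<close>.\<close>

lemma quaternion_pair:
  assumes y: "y \<in> X" and x: "x \<in> X" and yx: "y \<otimes> x \<in> X"
    and nc: "y \<otimes> x \<noteq> x \<otimes> y"
  shows "y \<otimes> x = inv x \<otimes> y" "x \<otimes> x = y \<otimes> y"
proof -
  have c: "y \<in> carrier G" "x \<in> carrier G" using y x XG by auto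
  have "y \<otimes> x = inv x \<otimes> y \<and> x \<otimes> x = y \<otimes> y"
  proof (cases "y \<otimes> x = inv x \<otimes> y")
    case True
    then show ?thesis using square_eq_if_inverts[OF y x yx nc] by simp
  next
    case False
    then have i: "x \<otimes> y = inv y \<otimes> x" using commute_or_invert[OF y x yx] nc by blast
    have i': "inv x \<otimes> inv y = inv (inv y) \<otimes> inv x"
      using inverts_inv(3)[OF c(2,1) i] c by simp
    have nc': "inv x \<otimes> inv y \<noteq> inv y \<otimes> inv x"
    proof
      assume "inv x \<otimes> inv y = inv y \<otimes> inv x"
      from mult_left_eqD[OF this, of "y \<otimes> x" "x \<otimes> y"] show False using c nc by (simp add: word_simps)
    qed
    have "inv x \<otimes> inv y \<in> X" using inv_X[OF yx] c by (simp add: inv_mult_group)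
    from square_eq_if_inverts[OF inv_X[OF x] inv_X[OF y] this nc' i']
    have "inv (y \<otimes> y) = inv (x \<otimes> x)" using c by (simp add: inv_mult_group)
    then have s: "x \<otimes> x = y \<otimes> y" using c by (metis inv_inv m_closed)
    have "y \<otimes> x = x \<otimes> inv y" using inverts_inv(1)[OF c(2,1) i] by simp
    also have "\<dots> = inv x \<otimes> (x \<otimes> x) \<otimes> inv y" using c by (simp add: word_simps)
    also have "\<dots> = inv x \<otimes> y" using s c by (simp add: word_simps)
    finally show ?thesis using s by simp
  qed
  then show "y \<otimes> x = inv x \<otimes> y" "x \<otimes> x = y \<otimes> y" by auto
qed

lemma cent_inv_X:
  assumes x: "x \<in> X"
  shows "cent_inv x = carrier G"
proof (rule subgroup_eq_carrier[of _ "{\<one>, x}"])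
  fix y assume "y \<in> carrier G" "\<forall>a\<in>{\<one>, x}. y \<otimes> a \<in> X"
  then show "y \<in> cent_inv x" using quaternion_pair(1)[of y x] x by (auto simp: cent_inv_def)
qed (use x XG subgroup_cent_inv card_doubleton_le[of \<one> x] in auto)

lemma noncentral_cent:
  assumes "x \<in> X" "x \<notin> centre"
  shows "cent x \<noteq> carrier G"
proof -
  obtain r where r: "r \<in> carrier G" "x \<otimes> r \<noteq> r \<otimes> x" using assms XG by (auto simp: centre_def)
  then have "r \<notin> cent x" by (simp add: cent_def)
  then show ?thesis using r by auto
qed

text \<open>Both centralisers have index two. They cut the group into at most four parts, and left
  translation carries each part into the part outside both, which is not empty because a group is not
  the union of two proper subgroups.\<close>

lemma card_outside_two_cents:
  assumes x: "x \<in> X" "x \<notin> centre" and x': "x' \<in> X" "x' \<notin> centre"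
  shows "order G \<le> 4 * card (carrier G - cent x - cent x')"
proof -
  have xc: "x \<in> carrier G" "x' \<in> carrier G" using x x' XG by auto
  interpret A: subgroup "cent x" G using xc by (intro subgroup_cent)
  interpret B: subgroup "cent x'" G using xc by (intro subgroup_cent)
  note A = mult_mem_cent_iff[OF xc(1) cent_inv_X[OF x(1)]]
    and B = mult_mem_cent_iff[OF xc(2) cent_inv_X[OF x'(1)]]
  have iA: "inv s \<in> cent x \<longleftrightarrow> s \<in> cent x" and iB: "inv s \<in> cent x' \<longleftrightarrow> s \<in> cent x'"
    if "s \<in> carrier G" for s
    using that A.m_inv_closed[of s] A.m_inv_closed[of "inv s"]
      B.m_inv_closed[of s] B.m_inv_closed[of "inv s"] by auto
  define T where "T p q = {r \<in> carrier G. (r \<in> cent x) = p \<and> (r \<in> cent x') = q}" for p q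
  have finT: "finite (T p q)" for p q using fin by (simp add: T_def)
  obtain a where a: "a \<in> carrier G" "a \<notin> cent x" using noncentral_cent[OF x] A.subset by blast
  obtain b where b: "b \<in> carrier G" "b \<notin> cent x'" using noncentral_cent[OF x'] B.subset by blast
  have "\<exists>s. s \<in> T False False"
    using a b A[of a b] B[of a b] m_closed[of a b] unfolding T_def by blast
  then obtain s where s: "s \<in> T False False" by blast
  have "card (T p q) \<le> card (T False False)" for p q
  proof (cases "T p q = {}")
    case False
    then obtain t where t: "t \<in> T p q" by blast
    have "s \<otimes> inv t \<otimes> r \<in> T False False" if "r \<in> T p q" for r
      using s t that by (simp add: T_def A B iA iB)
    then show ?thesis
      using s t by (intro card_le_translate[OF finT, of _ "s \<otimes> inv t"]) (auto simp: T_def)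
  qed simp
  note le = this
  have "order G = card ((T True True \<union> T True False) \<union> (T False True \<union> T False False))"
    unfolding order_def by (rule arg_cong[where f = card]) (auto simp: T_def)
  also have "\<dots> \<le> card (T True True) + card (T True False) + (card (T False True) + card (T False False))"
    using card_Un_le[of "T True True \<union> T True False" "T False True \<union> T False False"]
      card_Un_le[of "T True True" "T True False"] card_Un_le[of "T False True" "T False False"] by linarith
  also have "\<dots> \<le> 4 * card (T False False)" using le[of True True] le[of True False] le[of False True] by linarith
  also have "T False False = carrier G - cent x - cent x'" by (auto simp: T_def)
  finally show ?thesis .
qed

text \<open>Some \<open>y\<close> forms a quaternion pair with each of the two.\<close>

lemma same_square:
  assumes x: "x \<in> X" "x \<notin> centre" and x': "x' \<in> X" "x' \<notin> centre"
  shows "x \<otimes> x = x' \<otimes> x'"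
proof -
  let ?S = "carrier G - cent x - cent x'"
  have xc: "x \<in> carrier G" "x' \<in> carrier G" using x x' XG by auto
  have "card {\<one>, x, x'} \<le> 3" by (simp add: card_insert_if)
  then have "card {\<one>, x, x'} * order G \<le> 24 * card ?S"
    using card_outside_two_cents[OF x x'] mult_le_mono[of "card {\<one>, x, x'}" 3 "order G" "4 * card ?S"] by linarith
  then obtain y where y: "y \<in> ?S" "\<forall>a\<in>{\<one>, x, x'}. y \<otimes> a \<in> X"
    using ex_good[of "{\<one>, x, x'}" ?S] xc by blast
  then have "y \<in> X" "y \<otimes> x \<noteq> x \<otimes> y" "y \<otimes> x' \<noteq> x' \<otimes> y" by (auto simp: cent_def)
  then show ?thesis using quaternion_pair(2)[of y x] quaternion_pair(2)[of y x'] x x' y by auto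
qed

text \<open>For generic \<open>y\<close> outside the centraliser of \<open>w\<close>, both \<open>y\<close> and \<open>y \<otimes> x\<close> are noncentral elements of \<open>X\<close>,
  so they have the same square.\<close>

lemma central_square:
  assumes x: "x \<in> X" "x \<in> centre" and w: "w \<in> X" "w \<notin> centre"
  shows "x \<otimes> x = \<one>"
proof -
  have xc: "x \<in> carrier G" "w \<in> carrier G" using x w XG by auto
  have "order G \<le> 2 * card (carrier G - cent w)"
    using card_outside_proper_subgroup[OF fin subgroup_cent noncentral_cent] w xc by auto
  then have "card {\<one>, x} * order G \<le> 24 * card (carrier G - cent w)"
    using mult_le_mono[OF card_doubleton_le[of \<one> x], of "order G" "2 * card (carrier G - cent w)"] by linarith
  then obtain y where y: "y \<in> carrier G - cent w" "\<forall>a\<in>{\<one>, x}. y \<otimes> a \<in> X"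
    using ex_good[of "{\<one>, x}" "carrier G - cent w"] xc by blast
  then have yc: "y \<in> carrier G" "y \<in> X" "y \<otimes> w \<noteq> w \<otimes> y" by (auto simp: cent_def)
  have xw: "x \<otimes> w = w \<otimes> x" "x \<otimes> y = y \<otimes> x" using x(2) xc yc(1) by (auto simp: centre_def)
  have "y \<otimes> x \<otimes> w \<noteq> w \<otimes> (y \<otimes> x)"
  proof
    assume "y \<otimes> x \<otimes> w = w \<otimes> (y \<otimes> x)"
    then have "y \<otimes> w \<otimes> x = w \<otimes> y \<otimes> x" using xw(1) xc yc(1) by (simp add: m_assoc)
    then show False using yc xc by simp
  qed
  then have "y \<notin> centre" "y \<otimes> x \<notin> centre" using yc xc by (auto simp: centre_def)
  then have "y \<otimes> y = (y \<otimes> x) \<otimes> (y \<otimes> x)" using same_square[of y "y \<otimes> x"] yc y by simp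
  also have "\<dots> = y \<otimes> (x \<otimes> y) \<otimes> x" using xc yc by (simp add: m_assoc)
  also have "\<dots> = y \<otimes> (y \<otimes> x) \<otimes> x" using xw(2) by simp
  also have "\<dots> = y \<otimes> y \<otimes> (x \<otimes> x)" using xc yc by (simp add: m_assoc)
  finally show ?thesis using xc yc by simp
qed

text \<open>Fix a noncentral \<open>x \<in> X\<close>, let \<open>z = x\<^sup>2\<close> and \<open>A\<close> the centraliser of \<open>x\<close>. If \<open>d \<in> A\<close> is generic with
  \<open>d\<close> and \<open>dx\<close> noncentral, then \<open>z = (dx)\<^sup>2 = d\<^sup>2x\<^sup>2 = z\<^sup>2 = 1\<close>, which is impossible; hence \<open>A\<close> is the
  union of two cosets of the centre and is abelian. The centre has exponent two because its generic
  elements do. So anything that inverts \<open>x\<close> inverts \<open>A\<close>.\<close>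

lemma dicyclic: "generalised_dicyclic G"
proof -
  have "\<exists>x\<in>X. x \<notin> centre"
  proof (rule ccontr)
    assume "\<not> ?thesis"
    then have "centre = carrier G"
      by (intro subgroup_eq_carrier[of centre "{\<one>}"]) (auto simp: subgroup_centre)
    then show False using not_abelian by simp
  qed
  then obtain x where x: "x \<in> X" "x \<notin> centre" by blast
  have xc: "x \<in> carrier G" using x XG by auto
  define A where "A = cent x"
  define z where "z = x \<otimes> x"
  have zc: "z \<in> carrier G" using xc by (simp add: z_def)
  interpret Z: subgroup centre G by (rule subgroup_centre)
  have central: "c \<otimes> r = r \<otimes> c" if "c \<in> centre" "r \<in> carrier G" for c r
    using that unfolding centre_def by blast
  have A_comm: "a \<otimes> x = x \<otimes> a" if "a \<in> A" for a
    using that unfolding A_def cent_def by blast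
  have A_sub: "subgroup A G" using xc by (simp add: A_def subgroup_cent)
  then interpret A: subgroup A G .
  have A_proper: "A \<noteq> carrier G" using noncentral_cent[OF x] by (simp add: A_def)
  have "x \<notin> F" using x(2) F_sub_centre by blast
  then have z_ne: "z \<noteq> \<one>" using square_ne_one x(1) by (simp add: z_def)
  have out: "r \<otimes> x = inv x \<otimes> r" if "r \<in> carrier G" "r \<notin> A" for r
    using that cent_inv_X[OF x(1)] unfolding A_def cent_inv_def cent_def by blast
  have half: "order G \<le> 2 * card (carrier G - A)" "order G \<le> 2 * card A"
    using card_outside_proper_subgroup[OF fin A_sub A_proper] card_cent_ge_half[OF fin xc cent_inv_X[OF x(1)]]
    by (auto simp: A_def)
  \<comment> \<open>This \<open>y\<close>, not \<open>x\<close>, will be the generator of the dicyclic group outside \<open>A\<close>.\<close>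
  have "card {\<one>, x} * order G \<le> 24 * card (carrier G - A)"
    using half(1) mult_le_mono[OF card_doubleton_le[of \<one> x], of "order G" "2 * card (carrier G - A)"] by linarith
  then obtain y where y: "y \<in> carrier G - A" "\<forall>a\<in>{\<one>, x}. y \<otimes> a \<in> X"
    using ex_good[of "{\<one>, x}" "carrier G - A"] xc by blast
  have ya: "y \<in> carrier G" "y \<notin> A" using y(1) by auto
  then have "y \<otimes> x \<noteq> x \<otimes> y" unfolding A_def cent_def by blast
  moreover have "y \<in> X" using y(2) ya(1) by simp
  ultimately have yc: "y \<in> carrier G" "y \<in> X" "y \<notin> A" "y \<otimes> x \<noteq> x \<otimes> y" using ya by blast+
  have "y \<otimes> x \<in> X" using y(2) by simp
  then have yy: "y \<otimes> y = z" using quaternion_pair(2)[OF yc(2) x(1) _ yc(4)] by (simp add: z_def)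
  have yx: "y \<otimes> x = inv x \<otimes> y" using out yc by simp
  have zz: "z \<otimes> z = \<one>"
  proof -
    have "y \<otimes> z = inv z \<otimes> y"
    proof -
      have "y \<otimes> z = y \<otimes> x \<otimes> x" using yc xc by (simp add: z_def m_assoc)
      also have "\<dots> = inv x \<otimes> (y \<otimes> x)" using yc xc yx by (simp add: m_assoc)
      also have "\<dots> = inv z \<otimes> y" using yc xc yx by (simp add: z_def word_simps)
      finally show ?thesis .
    qed
    moreover have "y \<otimes> z = z \<otimes> y" using yc by (simp add: yy[symmetric] m_assoc)
    ultimately have "z = inv z" using yc zc by simp
    then show ?thesis using zc by (metis r_inv)
  qed
  have inv_x: "inv x = x \<otimes> z"
    using zz xc by (intro inv_equality) (simp_all add: z_def m_assoc)
  have z_centre: "z \<in> centre"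
  proof -
    have "z \<otimes> r = r \<otimes> z" if r: "r \<in> carrier G" for r
    proof (cases "r \<in> A")
      case True
      then have "x \<otimes> r = r \<otimes> x" using A_comm by simp
      then show ?thesis using commutes_mult[OF xc xc r] by (simp only: z_def)
    next
      case False
      have "r \<otimes> z = r \<otimes> x \<otimes> x" using r xc by (simp add: z_def m_assoc)
      also have "\<dots> = inv x \<otimes> (r \<otimes> x)" using out[OF r False] r xc by (simp add: m_assoc)
      also have "\<dots> = inv z \<otimes> r" using out[OF r False] r xc by (simp add: z_def word_simps)
      also have "inv z = z" using zz zc by (simp add: inv_equality)
      finally show ?thesis by simp
    qed
    then show ?thesis using zc unfolding centre_def by blast
  qed
  have A_iff: "a \<in> centre \<or> a \<otimes> x \<in> centre" if a: "a \<in> A" for a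
  proof (rule ccontr)
    assume n: "\<not> ?thesis"
    \<comment> \<open>\<open>K\<close> is a subgroup of \<open>A\<close>; once its complement \<open>D\<close> contains \<open>a\<close>, it contains a coset of \<open>K\<close>
      and is thus at least half of \<open>A\<close>, large enough to have generic elements.\<close>
    define D where "D = {d \<in> A. d \<notin> centre \<and> d \<otimes> x \<notin> centre}"
    define K where "K = {k \<in> A. k \<in> centre \<or> k \<otimes> x \<in> centre}"
    have ac: "a \<in> carrier G" using a by auto
    have finA: "finite A" using A.subset fin by (rule finite_subset)
    have "a \<otimes> k \<in> D" if k: "k \<in> K" for k
    proof -
      have kc: "k \<in> carrier G" "k \<in> A" using k by (auto simp: K_def)
      have kx: "k \<otimes> x = x \<otimes> k" using kc A_comm by simp
      have kk: "k \<in> centre \<or> k \<otimes> x \<in> centre" using k by (simp add: K_def)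
      have 1: "c \<notin> centre" if "d \<notin> centre" "c = d \<otimes> e" "e \<in> centre" "d \<in> carrier G" for c d e
      proof
        assume "c \<in> centre"
        then have "c \<otimes> inv e \<in> centre" using that by simp
        then show False using that by (simp add: m_assoc)
      qed
      have axz: "a \<otimes> x \<otimes> z = a \<otimes> inv x" using inv_x ac xc zc by (simp add: m_assoc)
      have n': "a \<notin> centre" "a \<otimes> x \<notin> centre" using n by auto
      show ?thesis
      proof (cases "k \<in> centre")
        case True
        have "a \<otimes> k \<otimes> x = a \<otimes> x \<otimes> k" using kx ac kc xc by (simp add: m_assoc)
        then show ?thesis using 1[OF n'(1) HOL.refl True] 1[OF n'(2) _ True] ac xc a kc by (auto simp: D_def)
      next
        case False
        then have kxz: "k \<otimes> x \<in> centre" using kk by simp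
        have "a \<otimes> k = a \<otimes> inv x \<otimes> (k \<otimes> x)"
          using ac kc xc by (simp add: kx word_simps)
        also have "\<dots> = a \<otimes> x \<otimes> (z \<otimes> (k \<otimes> x))" using axz[symmetric] ac kc xc zc by (simp add: m_assoc)
        finally have "a \<otimes> k \<notin> centre" using 1[OF n'(2)] z_centre kxz ac xc by auto
        moreover have "a \<otimes> k \<otimes> x \<notin> centre" using 1[OF n'(1) _ kxz] ac kc xc by (auto simp: m_assoc)
        ultimately show ?thesis using a kc by (simp add: D_def)
      qed
    qed
    note DK = this
    have "finite D" "K \<subseteq> carrier G" using finA A.subset by (auto simp: K_def D_def)
    then have "card K \<le> card D" using DK by (rule card_le_translate[OF _ _ ac])
    moreover have "card A = card K + card D"
    proof -
      have "A = K \<union> D" "K \<inter> D = {}" by (auto simp: K_def D_def)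
      then show ?thesis using card_Un_disjoint[of K D] finA by simp
    qed
    ultimately have "order G \<le> 4 * card D" using half(2) by linarith
    then have "card {\<one>, x} * order G \<le> 24 * card D"
      using mult_le_mono[OF card_doubleton_le[of \<one> x], of "order G" "4 * card D"] by linarith
    then obtain d where d: "d \<in> D" "\<forall>a\<in>{\<one>, x}. d \<otimes> a \<in> X"
      using ex_good[of "{\<one>, x}" D] xc A.subset by (auto simp: D_def)
    have "d \<in> A" using d(1) by (simp add: D_def)
    then have dc: "d \<in> carrier G" "d \<notin> centre" "d \<otimes> x \<notin> centre" "d \<otimes> x = x \<otimes> d"
      using d(1) A_comm[of d] A.mem_carrier[of d] unfolding D_def by blast+
    have dd: "d \<otimes> d = z" "(d \<otimes> x) \<otimes> (d \<otimes> x) = z"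
      using same_square[OF _ dc(2) x] same_square[OF _ dc(3) x] d dc(1) by (simp_all add: z_def)
    have "z = d \<otimes> (x \<otimes> d) \<otimes> x" using dd(2) dc(1) xc by (simp add: m_assoc)
    also have "\<dots> = d \<otimes> (d \<otimes> x) \<otimes> x" using dc(4) by simp
    also have "\<dots> = d \<otimes> d \<otimes> (x \<otimes> x)" using dc(1) xc by (simp add: m_assoc)
    also have "\<dots> = \<one>" using dd(1) zz by (simp add: z_def)
    finally show False using z_ne by simp
  qed
  have centre_square: "c \<otimes> c = \<one>" if c: "c \<in> centre" for c
  proof (rule ccontr)
    assume n: "c \<otimes> c \<noteq> \<one>"
    \<comment> \<open>As before, the coset \<open>cK\<close> makes \<open>D\<close> at least half of the centre, an eighth of the group.\<close>
    define D where "D = {d \<in> centre. d \<otimes> d \<noteq> \<one>}"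
    define K where "K = {k \<in> centre. k \<otimes> k = \<one>}"
    have finZ: "finite centre" using Z.subset fin by (rule finite_subset)
    have "c \<otimes> k \<in> D" if k: "k \<in> K" for k
    proof -
      have kc: "k \<in> carrier G" "k \<in> centre" "c \<in> carrier G" using k c by (auto simp: K_def)
      have "c \<otimes> k \<otimes> (c \<otimes> k) = c \<otimes> (k \<otimes> c) \<otimes> k" using kc by (simp add: m_assoc)
      also have "\<dots> = c \<otimes> (c \<otimes> k) \<otimes> k" using central[OF kc(2) kc(3)] by simp
      also have "\<dots> = c \<otimes> c \<otimes> (k \<otimes> k)" using kc by (simp add: m_assoc)
      also have "\<dots> = c \<otimes> c" using k kc by (simp add: K_def)
      finally show ?thesis using n kc c by (simp add: D_def)
    qed
    note DK = this
    have "finite D" "K \<subseteq> carrier G" using finZ Z.subset by (auto simp: K_def D_def)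
    then have "card K \<le> card D" using DK by (rule card_le_translate[OF _ _ centre_carrier[OF c]])
    moreover have "card centre = card K + card D"
    proof -
      have "centre = K \<union> D" "K \<inter> D = {}" by (auto simp: K_def D_def)
      then show ?thesis using card_Un_disjoint[of K D] finZ by simp
    qed
    moreover have "card A \<le> 2 * card centre"
    proof -
      have "card {a \<in> A. a \<otimes> x \<in> centre} \<le> card centre"
        by (rule card_inj_on_le[of "\<lambda>a. a \<otimes> x"]) (use finZ xc in \<open>auto simp: inj_on_def\<close>)
      moreover have "A \<subseteq> centre \<union> {a \<in> A. a \<otimes> x \<in> centre}" using A_iff by auto
      moreover have "finite (centre \<union> {a \<in> A. a \<otimes> x \<in> centre})"
        using finZ A.subset fin by (auto intro: finite_subset)
      ultimately show ?thesis
        using card_mono[of "centre \<union> {a \<in> A. a \<otimes> x \<in> centre}" A]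
          card_Un_le[of centre "{a \<in> A. a \<otimes> x \<in> centre}"] by linarith
    qed
    ultimately have "card {\<one>} * order G \<le> 24 * card D" using half(2) by simp
    then obtain d where "d \<in> D" "d \<otimes> \<one> \<in> X"
      using ex_good[of "{\<one>}" D] Z.subset by (auto simp: D_def)
    then show False using central_square[OF _ _ x] centre_carrier by (auto simp: D_def)
  qed
  show ?thesis
  proof (rule generalised_dicyclicI[OF fin A_sub, of x y])
    show "x \<in> A" unfolding A_def cent_def using xc by blast
    show "x \<otimes> x \<noteq> \<one>" using z_ne by (simp only: z_def not_False_eq_True)
    show "y \<in> carrier G" "y \<notin> A" using yc by auto
    have "z \<in> A" unfolding A_def cent_def using central[OF z_centre xc] zc by blast
    then show "y \<otimes> y \<in> A" "y \<otimes> y \<noteq> \<one>" using yy z_ne by simp_all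
    show "inv y \<otimes> r \<in> A" if "r \<in> carrier G" "r \<notin> A" for r
      using inverts_twice(1)[OF yc(1) that(1) xc yx out[OF that]] by (simp add: A_def)
  next
    fix a b assume ab: "a \<in> A" "b \<in> A"
    have c: "a \<in> carrier G" "b \<in> carrier G" "x \<otimes> a = a \<otimes> x" using ab A_comm by auto
    show "a \<otimes> b = b \<otimes> a"
    proof (cases "b \<in> centre")
      case True
      then show ?thesis using central[of b a] c by simp
    next
      case False
      then have "b \<otimes> x \<in> centre" using A_iff ab by blast
      then have "a \<otimes> (b \<otimes> x) = b \<otimes> x \<otimes> a" using central[of "b \<otimes> x" a] c by simp
      then have "a \<otimes> b \<otimes> x = b \<otimes> a \<otimes> x" using c xc by (simp add: m_assoc)
      then show ?thesis using c xc by simp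
    qed
  next
    fix h assume h: "h \<in> A"
    have hc: "h \<in> carrier G" "h \<otimes> x = x \<otimes> h" using h A_comm by auto
    have "y \<otimes> h = inv h \<otimes> y"
    proof (cases "h \<in> centre")
      case True
      then show ?thesis using central[OF True yc(1)] centre_square[OF True] hc by (simp add: inv_equality)
    next
      case False
      then have hx: "h \<otimes> x \<in> centre" using A_iff h by blast
      define c where "c = h \<otimes> x"
      have cc: "c \<in> carrier G" "c \<in> centre" using hx hc xc by (auto simp: c_def)
      have hci: "h = c \<otimes> inv x" using hc(1) xc by (simp add: c_def word_simps)
      have ci: "inv c = c" using centre_square[OF cc(2)] cc by (simp add: inv_equality)
      have "y \<otimes> h = (y \<otimes> c) \<otimes> inv x" using hci yc cc xc by (simp add: m_assoc)
      also have "\<dots> = c \<otimes> (y \<otimes> inv x)" using central[OF cc(2) yc(1)] yc cc xc by (simp add: m_assoc[symmetric])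
      also have "\<dots> = c \<otimes> (x \<otimes> y)" using inverts_inv(1)[OF yc(1) xc yx] by simp
      also have "\<dots> = x \<otimes> c \<otimes> y" using central[OF cc(2) xc] yc cc xc by (simp add: m_assoc[symmetric])
      also have "x \<otimes> c = inv h" using hci cc xc ci by (simp add: inv_mult_group)
      finally show ?thesis .
    qed
    then have "inv y \<otimes> h = inv h \<otimes> inv y" using inverts_inv(2) yc(1) hc(1) by blast
    then show "inv y \<otimes> h \<otimes> y = inv h" using yc(1) hc(1) by (simp add: m_assoc)
  qed
qed

end

theorem (in dense_inverted) abelian_or_dicyclic:
  "comm_group G \<and> group_exponent G > 2 \<or> generalised_dicyclic G"
proof (cases "\<exists>f\<in>F. f \<otimes> f \<noteq> \<one>")
  case True
  then show ?thesis using dicyclic_of_F_exponent_gt_2 by blast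
next
  case F2: False
  show ?thesis
  proof (cases "centre = carrier G")
    case True
    then have "comm_group G" by unfold_locales (auto simp: centre_def)
    moreover obtain x where "x \<in> X" "x \<notin> F" using ex_moved by blast
    ultimately show ?thesis using group_exponent_gt_2[OF fin, of x] square_ne_one XG by auto
  next
    case False
    then interpret dense_inverted_central G F X
      using F2 by unfold_locales auto
    show ?thesis using dicyclic by simp
  qed
qed

section \<open>Counting inverse-closed sets that do not separate points\<close>

text \<open>Each member of the family is the union of the classes that it contains.\<close>

lemma card_family_le_indistinguishable_classes:
  assumes V: "finite V" and T: "T \<subseteq> Pow V"
  defines "r \<equiv> {(x, y) \<in> V \<times> V. \<forall>S\<in>T. x \<in> S \<longleftrightarrow> y \<in> S}"
  shows "equiv V r" "card T \<le> 2 ^ card (V // r)"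
proof -
  show eq: "equiv V r" unfolding r_def by (rule equivI) (auto simp: refl_on_def sym_def trans_def)
  define f where "f S = {B \<in> V // r. B \<subseteq> S}" for S
  have U: "\<Union>(f S) = S" if S: "S \<in> T" for S
  proof
    show "S \<subseteq> \<Union>(f S)"
    proof
      fix x assume x: "x \<in> S"
      then have xV: "x \<in> V" using S T by auto
      then have "r `` {x} \<in> V // r" "x \<in> r `` {x}" by (auto simp: quotient_def r_def)
      moreover have "r `` {x} \<subseteq> S" using x S by (auto simp: r_def)
      ultimately show "x \<in> \<Union>(f S)" by (auto simp: f_def)
    qed
  qed (auto simp: f_def)
  have finQ: "finite (V // r)" using V by (rule finite_quotient) (auto simp: r_def)
  have "inj_on f T" by (rule inj_on_inverseI[where g = Union]) (rule U)
  moreover have "f ` T \<subseteq> Pow (V // r)" by (auto simp: f_def)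
  ultimately have "card T \<le> card (Pow (V // r))" using finQ by (intro card_inj_on_le) auto
  then show "card T \<le> 2 ^ card (V // r)" using finQ by (simp add: card_Pow)
qed

lemma card_eq_sum_quotient:
  assumes "finite V" "equiv V r" "M \<subseteq> V"
  shows "card M = (\<Sum>B\<in>V // r. card (B \<inter> M))"
proof -
  have "M = (\<Union>B\<in>V // r. B \<inter> M)" using assms Union_quotient[OF assms(2)] by blast
  then have "card M = card (\<Union>B\<in>V // r. B \<inter> M)" by simp
  also have "\<dots> = (\<Sum>B\<in>V // r. card (B \<inter> M))"
  proof (rule card_UN_disjoint)
    show "finite (V // r)" using assms by (simp add: finite_quotient equiv_type)
    show "\<forall>B\<in>V // r. finite (B \<inter> M)" using assms by (auto intro: finite_subset)
    show "\<forall>B\<in>V // r. \<forall>C\<in>V // r. B \<noteq> C \<longrightarrow> (B \<inter> M) \<inter> (C \<inter> M) = {}"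
      using quotient_disj[OF assms(2)] by blast
  qed
  finally show ?thesis .
qed

text \<open>With this weighting of points, in which elements equal to their inverse count twice, every class \<open>{x, x\<^sup>-\<^sup>1}\<close> has
  weight two. The total weight of the group is then twice the exponent \<open>c(R)\<close> of the number of
  inverse-closed subsets.\<close>

lemma (in group) card_inverse_pair:
  assumes x: "x \<in> carrier G"
  shows "card {x, inv x} + card ({x, inv x} \<inter> {u \<in> carrier G. u [^] (2::nat) = \<one>}) = 2"
proof -
  define I where "I = {u \<in> carrier G. u [^] (2::nat) = \<one>}"
  have I: "u \<in> I \<longleftrightarrow> inv u = u" if "u \<in> carrier G" for u
  proof -
    have "u [^] (2::nat) = u \<otimes> u" using that by (simp add: numeral_2_eq_2)
    moreover have "u \<otimes> u = \<one> \<longleftrightarrow> inv u = u" using that inv_equality[of u u] r_inv[of u] by metis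
    ultimately show ?thesis using that by (simp add: I_def)
  qed
  have "card {x, inv x} + card ({x, inv x} \<inter> I) = 2"
  proof (cases "inv x = x")
    case True
    then show ?thesis using I[OF x] by simp
  next
    case False
    then have "{x, inv x} \<inter> I = {}" using I[OF x] I[of "inv x"] x by auto
    then show ?thesis using False by (simp add: card_insert_if)
  qed
  then show ?thesis by (simp add: I_def)
qed

lemma block_arith:
  fixes a b c d e f n :: nat
  assumes "a + b \<le> c" "d + e \<le> f" "n \<le> c" "a + d = 2" "b + e = 2"
  shows "4 + n \<le> 2 * (c + f)"
  using assms by simp

text \<open>Inverse-closed subsets in general are unions of the classes \<open>{x, x\<^sup>-\<^sup>1}\<close>. A family that never
  separates \<open>x \<in> N\<close> from some element of another class merges these classes into larger blocks. A
  block of weight \<open>w\<close> replaces \<open>w/2\<close> classes by one, and one that meets \<open>N\<close> has weight at least four,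
  so that it costs at least a quarter of its size in the exponent.\<close>

lemma (in group) card_inverse_closed_family_le:
  assumes fin: "finite (carrier G)" and T: "T \<subseteq> inverse_closed_subsets G"
    and N: "N \<subseteq> carrier G"
    and N_merged: "\<And>x. x \<in> N \<Longrightarrow>
      \<exists>t\<in>carrier G. t \<noteq> x \<and> t \<noteq> inv x \<and> (\<forall>S\<in>T. x \<in> S \<longleftrightarrow> t \<in> S)"
  shows "real (card T) \<le> 2 powr (cayley_exponent G - real (card N) / 4)"
proof -
  define r where "r = {(x, y) \<in> carrier G \<times> carrier G. \<forall>S\<in>T. x \<in> S \<longleftrightarrow> y \<in> S}"
  define I where "I = {u \<in> carrier G. u [^] (2::nat) = \<one>}"
  define Q where "Q = carrier G // r"
  have TP: "T \<subseteq> Pow (carrier G)" using T by (auto simp: inverse_closed_subsets_def)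
  have eq: "equiv (carrier G) r" and cT: "card T \<le> 2 ^ card Q"
    using card_family_le_indistinguishable_classes[OF fin TP] unfolding r_def Q_def by auto
  have r_inv: "(x, inv x) \<in> r" if x: "x \<in> carrier G" for x
  proof -
    have "x \<in> S \<longleftrightarrow> inv x \<in> S" if "S \<in> T" for S
    proof -
      have "S \<subseteq> carrier G" "set_inv S = S" using that T by (auto simp: inverse_closed_subsets_def)
      then have "\<forall>s\<in>S. inv s \<in> S" using set_inv_eq_iff by blast
      then show ?thesis using inv_inv[OF x] by metis
    qed
    then show ?thesis using x by (simp add: r_def)
  qed
  \<comment> \<open>Stated with \<open>B \<inter> carrier G\<close> so that the sums over blocks match \<open>card_eq_sum_quotient\<close>.\<close>
  have block: "4 + card (B \<inter> N) \<le> 2 * (card (B \<inter> carrier G) + card (B \<inter> I))" if B: "B \<in> Q" for B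
  proof -
    have Bc: "B \<subseteq> carrier G" using B eq unfolding Q_def by (metis Union_quotient Union_upper)
    have finB: "finite B" using Bc fin by (rule finite_subset)
    have closed: "y \<in> B" if "x \<in> B" "(x, y) \<in> r" for x y
      using that B eq unfolding Q_def by (metis in_quotient_imp_closed)
    have pair: "{x, inv x} \<subseteq> B" if "x \<in> B" for x using that closed r_inv Bc by blast
    have card_pair: "card {x, inv x} + card ({x, inv x} \<inter> I) = 2" if "x \<in> B" for x
      using card_inverse_pair[of x] that Bc unfolding I_def by blast
    have Bcap: "B \<inter> carrier G = B" using Bc by blast
    show ?thesis
    proof (cases "B \<inter> N = {}")
      case True
      obtain x where x: "x \<in> B"
        using in_quotient_imp_non_empty[OF eq] B unfolding Q_def by blast
      have "card {x, inv x} \<le> card B" "card ({x, inv x} \<inter> I) \<le> card (B \<inter> I)"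
        using pair[OF x] finB by (auto intro!: card_mono)
      then have "2 \<le> card B + card (B \<inter> I)" using card_pair[OF x] by linarith
      then show ?thesis using True unfolding Bcap by simp
    next
      case False
      then obtain x where x: "x \<in> B" "x \<in> N" by blast
      then obtain t where t: "t \<in> carrier G" "t \<noteq> x" "t \<noteq> inv x" "\<forall>S\<in>T. x \<in> S \<longleftrightarrow> t \<in> S"
        using N_merged by blast
      have xc: "x \<in> carrier G" using x Bc by blast
      have "t \<in> B" using closed[OF x(1), of t] t xc by (simp add: r_def)
      have dis: "{x, inv x} \<inter> {t, inv t} = {}"
        using t(1-3) xc inv_inv[OF t(1)] inv_inv[OF xc] by auto
      have "card {x, inv x} + card {t, inv t} = card ({x, inv x} \<union> {t, inv t})"
        using dis by (intro card_Un_disjoint[symmetric]) auto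
      also have "\<dots> \<le> card B" using pair[OF x(1)] pair[OF \<open>t \<in> B\<close>] finB by (intro card_mono) auto
      finally have 1: "card {x, inv x} + card {t, inv t} \<le> card B" .
      have dis_I: "({x, inv x} \<inter> I) \<inter> ({t, inv t} \<inter> I) = {}" using dis by (metis Int_assoc Int_commute Int_empty_right Int_left_commute)
      have "card ({x, inv x} \<inter> I) + card ({t, inv t} \<inter> I) = card (({x, inv x} \<inter> I) \<union> ({t, inv t} \<inter> I))"
        using card_Un_disjoint[OF _ _ dis_I] by simp
      also have "\<dots> \<le> card (B \<inter> I)" using pair[OF x(1)] pair[OF \<open>t \<in> B\<close>] finB by (intro card_mono) auto
      finally have 2: "card ({x, inv x} \<inter> I) + card ({t, inv t} \<inter> I) \<le> card (B \<inter> I)" .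
      have 3: "card (B \<inter> N) \<le> card B" using finB by (intro card_mono) auto
      from block_arith[OF 1 2 3 card_pair[OF x(1)] card_pair[OF \<open>t \<in> B\<close>]] show ?thesis unfolding Bcap .
    qed
  qed
  have "(\<Sum>B\<in>Q. 4 + card (B \<inter> N)) \<le> (\<Sum>B\<in>Q. 2 * (card (B \<inter> carrier G) + card (B \<inter> I)))"
    by (rule sum_mono) (rule block)
  moreover have "(\<Sum>B\<in>Q. 4 + card (B \<inter> N)) = 4 * card Q + card N"
    using card_eq_sum_quotient[OF fin eq N] by (simp add: sum.distrib Q_def)
  moreover have "(\<Sum>B\<in>Q. 2 * (card (B \<inter> carrier G) + card (B \<inter> I))) = 2 * (order G + card I)"
    using card_eq_sum_quotient[OF fin eq, of "carrier G"] card_eq_sum_quotient[OF fin eq, of I]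
    by (simp add: sum.distrib sum_distrib_left[symmetric] Q_def I_def order_def)
  ultimately have "4 * card Q + card N \<le> 2 * (order G + card I)" by simp
  then have "4 * real (card Q) + real (card N) \<le> 2 * real (order G + card I)" by linarith
  then have "real (card Q) \<le> cayley_exponent G - real (card N) / 4"
    unfolding cayley_exponent_eq[OF fin] I_def by (simp add: field_simps)
  moreover have "real (card T) \<le> 2 powr real (card Q)"
    using cT by (metis of_nat_le_iff of_nat_numeral of_nat_power powr_realpow zero_less_numeral)
  ultimately show ?thesis by (meson order_trans powr_mono one_le_numeral)
qed

section \<open>Point stabilisers in overgroups of the regular representation\<close>

locale regular_overgroup = group R for R (structure) +
  fixes G
  assumes fin: "finite (carrier R)"
    and G: "subgroup G (BijGroup (carrier R))"
    and regular: "right_regular R \<subset> G"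
begin

definition stab :: "('a \<Rightarrow> 'a) set" where
  "stab = {g \<in> G. g \<one> = \<one>}"

definition fixed :: "'a set" where
  "fixed = {x \<in> carrier R. \<forall>g\<in>stab. g x = x}"

definition fixed_or_inverted :: "'a set" where
  "fixed_or_inverted = {x \<in> carrier R. \<forall>g\<in>stab. g x \<in> {x, inv x}}"

lemma G_Bij: "g \<in> G \<Longrightarrow> g \<in> Bij (carrier R)"
  using subgroup.subset[OF G] by (auto simp: BijGroup_def)

lemma G_closed: "g \<in> G \<Longrightarrow> x \<in> carrier R \<Longrightarrow> g x \<in> carrier R"
  using G_Bij by (auto simp: Bij_def bij_betw_def)

lemma G_compose: "g \<in> G \<Longrightarrow> h \<in> G \<Longrightarrow> compose (carrier R) g h \<in> G"
  using subgroup.m_closed[OF G, of g h] G_Bij by (simp add: BijGroup_def)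

lemma stab_sub: "g \<in> stab \<Longrightarrow> g \<in> G"
  by (simp add: stab_def)

lemma stab_one: "g \<in> stab \<Longrightarrow> g \<one> = \<one>"
  by (simp add: stab_def)

lemma fixedD: "x \<in> fixed \<Longrightarrow> g \<in> stab \<Longrightarrow> g x = x"
  by (simp add: fixed_def)

lemma translate_in_G: "r \<in> carrier R \<Longrightarrow> (\<lambda>x\<in>carrier R. x \<otimes> r) \<in> G"
  using regular by (auto simp: right_regular_def)

text \<open>Elements of the stabiliser need not be automorphisms of \<open>R\<close>, but composing one with translations
  on both sides gives another, namely \<open>g' = \<rho>(g x)\<^sup>-\<^sup>1 g \<rho>(x)\<close>, where \<open>\<rho>\<close> denotes right translation. Together with
  the nontriviality of the stabiliser, this twisted multiplicativity is all that the structural part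
  of the proof uses of \<open>G\<close>.\<close>

lemma stab_cocycle:
  assumes g: "g \<in> stab" and x: "x \<in> carrier R"
  obtains g' where "g' \<in> stab" "\<And>y. y \<in> carrier R \<Longrightarrow> g (y \<otimes> x) = g' y \<otimes> g x"
proof
  have gG: "g \<in> G" using g by (rule stab_sub)
  have gx: "g x \<in> carrier R" using G_closed[OF gG x] .
  define g' where "g' = compose (carrier R) (\<lambda>y\<in>carrier R. y \<otimes> inv (g x))
    (compose (carrier R) g (\<lambda>y\<in>carrier R. y \<otimes> x))"
  have "g' \<in> G" unfolding g'_def using gG gx x by (intro G_compose translate_in_G) auto
  have val: "g' y = g (y \<otimes> x) \<otimes> inv (g x)" if "y \<in> carrier R" for y
    using that x G_closed[OF gG] by (simp add: g'_def compose_def)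
  show "g' \<in> stab" using \<open>g' \<in> G\<close> val[of \<one>] x gx by (simp add: stab_def)
  show "g (y \<otimes> x) = g' y \<otimes> g x" if "y \<in> carrier R" for y
    using val[OF that] gx x that G_closed[OF gG, of "y \<otimes> x"] by (simp add: m_assoc)
qed

lemma one_fixed: "\<one> \<in> fixed"
  by (simp add: fixed_def stab_def)

lemma fixed_inv:
  assumes x: "x \<in> fixed"
  shows "inv x \<in> fixed"
proof -
  have xc: "x \<in> carrier R" using x by (simp add: fixed_def)
  have "g (inv x) = inv x" if g: "g \<in> stab" for g
  proof -
    obtain g' where g': "g' \<in> stab" "\<And>y. y \<in> carrier R \<Longrightarrow> g (y \<otimes> inv x) = g' y \<otimes> g (inv x)"
      using stab_cocycle[OF g, of "inv x"] xc by auto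
    have "x \<otimes> g (inv x) = \<one>" using g'(2)[OF xc] stab_one[OF g] fixedD[OF x g'(1)] xc by simp
    then show ?thesis
      using xc G_closed[OF stab_sub[OF g], of "inv x"] inv_comm[of x "g (inv x)"] inv_equality[of "g (inv x)" x]
      by simp
  qed
  then show ?thesis using xc by (simp add: fixed_def)
qed

lemma fixed_mult:
  assumes "x \<in> fixed" "y \<in> fixed"
  shows "y \<otimes> x \<in> fixed"
proof -
  have c: "x \<in> carrier R" "y \<in> carrier R" using assms by (auto simp: fixed_def)
  have "g (y \<otimes> x) = y \<otimes> x" if g: "g \<in> stab" for g
  proof -
    obtain g' where g': "g' \<in> stab" "\<And>y. y \<in> carrier R \<Longrightarrow> g (y \<otimes> x) = g' y \<otimes> g x"
      using stab_cocycle[OF g c(1)] by auto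
    then show ?thesis using g'(2)[OF c(2)] fixedD[OF assms(1) g] fixedD[OF assms(2) g'(1)] by simp
  qed
  then show ?thesis using c by (simp add: fixed_def)
qed

lemma subgroup_fixed: "subgroup fixed R"
  using one_fixed fixed_inv fixed_mult by (intro subgroupI) (auto simp: fixed_def)

lemma fixed_or_inverted_inv:
  assumes x: "x \<in> fixed_or_inverted"
  shows "inv x \<in> fixed_or_inverted"
proof -
  have xc: "x \<in> carrier R" using x by (simp add: fixed_or_inverted_def)
  have "g (inv x) \<in> {inv x, x}" if g: "g \<in> stab" for g
  proof -
    obtain g' where g': "g' \<in> stab" "\<And>y. y \<in> carrier R \<Longrightarrow> g (y \<otimes> inv x) = g' y \<otimes> g (inv x)"
      using stab_cocycle[OF g, of "inv x"] xc by auto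
    have "g' x \<otimes> g (inv x) = \<one>" using g'(2)[OF xc] g xc by (simp add: stab_def)
    then have "inv (g (inv x)) = g' x"
      using G_closed[OF stab_sub[OF g], of "inv x"] G_closed[OF stab_sub[OF g'(1)], of x] xc
      by (intro inv_equality) auto
    then have "g (inv x) = inv (g' x)" using G_closed[OF stab_sub[OF g], of "inv x"] xc by (metis inv_closed inv_inv)
    moreover have "g' x \<in> {x, inv x}" using x g'(1) by (simp add: fixed_or_inverted_def)
    ultimately show ?thesis using xc by auto
  qed
  then show ?thesis using xc by (simp add: fixed_or_inverted_def)
qed

text \<open>Composing some \<open>g \<in> G\<close> that is not a translation with a translation yields a nontrivial element
  of the stabiliser.\<close>

lemma fixed_proper: "fixed \<noteq> carrier R"
proof
  assume all: "fixed = carrier R"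
  obtain g where g: "g \<in> G" "g \<notin> right_regular R" using regular by blast
  define r where "r = g \<one>"
  have r: "r \<in> carrier R" using G_closed[OF g(1)] by (simp add: r_def)
  define h where "h = compose (carrier R) (\<lambda>y\<in>carrier R. y \<otimes> inv r) g"
  have h: "h y = g y \<otimes> inv r" if "y \<in> carrier R" for y
    using that G_closed[OF g(1)] by (simp add: h_def compose_def)
  have "h \<in> G" unfolding h_def using g r by (intro G_compose translate_in_G) auto
  then have "h \<in> stab" using h[of \<one>] r by (simp add: stab_def r_def[symmetric])
  have "g y = y \<otimes> r" if y: "y \<in> carrier R" for y
  proof -
    have gy: "g y \<in> carrier R" using G_closed[OF g(1) y] .
    have "g y \<otimes> inv r = y" using h[OF y] fixedD[OF _ \<open>h \<in> stab\<close>] y all by simp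
    then have "g y \<otimes> inv r \<otimes> r = y \<otimes> r" by simp
    then show ?thesis using gy r by (simp add: m_assoc)
  qed
  then have "g = (\<lambda>x\<in>carrier R. x \<otimes> r)"
    using G_Bij[OF g(1)] by (intro extensionalityI[of _ "carrier R"]) (auto simp: Bij_def)
  then show False using g(2) r by (auto simp: right_regular_def)
qed

text \<open>The neighbourhood \<open>S\<close> of the identity in a \<open>G\<close>-invariant Cayley graph is a union of orbits of the
  stabiliser, so an element \<open>x\<close> that is neither fixed nor inverted by some \<open>g\<close> is merged with
  \<open>g x \<notin> {x, x\<^sup>-\<^sup>1}\<close>.\<close>

lemma card_cayley_graphs_le:
  "real (card {\<Gamma> \<in> cayley_graphs R. G \<subseteq> digraph_auts \<Gamma>})
     \<le> 2 powr (cayley_exponent R - real (card (carrier R - fixed_or_inverted)) / 4)"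
proof -
  define T where "T = {S \<in> inverse_closed_subsets R. \<forall>g\<in>stab. \<forall>x\<in>carrier R. x \<in> S \<longleftrightarrow> g x \<in> S}"
  have "{\<Gamma> \<in> cayley_graphs R. G \<subseteq> digraph_auts \<Gamma>} \<subseteq> cayley_digraph R ` T"
  proof clarify
    fix \<Gamma> assume "\<Gamma> \<in> cayley_graphs R" and G_auts: "G \<subseteq> digraph_auts \<Gamma>"
    then obtain S where S: "pair_pseudo_graph \<Gamma>" "S \<subseteq> carrier R" "\<Gamma> = cayley_digraph R S"
      by (auto simp: cayley_graphs_def)
    then have "S \<in> inverse_closed_subsets R"
      using cayley_digraph_graph_iff[OF fin S(2)] by (simp add: inverse_closed_subsets_def)
    moreover have "x \<in> S \<longleftrightarrow> g x \<in> S" if g: "g \<in> stab" and x: "x \<in> carrier R" for g x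
    proof -
      have arcs: "(\<one>, z) \<in> parcs \<Gamma> \<longleftrightarrow> z \<in> S" if "z \<in> carrier R" for z
        using that S by (simp add: cayley_digraph_def)
      have "pverts \<Gamma> = carrier R" using S by (simp add: cayley_digraph_def)
      then have "(g \<one>, g x) \<in> parcs \<Gamma> \<longleftrightarrow> (\<one>, x) \<in> parcs \<Gamma>"
        using G_auts stab_sub[OF g] x unfolding digraph_auts_def by blast
      then show ?thesis
        using arcs[OF x] arcs[OF G_closed[OF stab_sub[OF g] x]] g by (simp add: stab_def)
    qed
    ultimately show "\<Gamma> \<in> cayley_digraph R ` T" using S(3) by (auto simp: T_def)
  qed
  moreover have "finite T"
    using fin by (intro finite_subset[of T "Pow (carrier R)"]) (auto simp: T_def inverse_closed_subsets_def)
  ultimately have "card {\<Gamma> \<in> cayley_graphs R. G \<subseteq> digraph_auts \<Gamma>} \<le> card T"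
    by (meson card_image_le card_mono finite_imageI order_trans)
  moreover have "real (card T) \<le> 2 powr (cayley_exponent R - real (card (carrier R - fixed_or_inverted)) / 4)"
  proof (rule card_inverse_closed_family_le[OF fin])
    fix x assume "x \<in> carrier R - fixed_or_inverted"
    then obtain g where g: "g \<in> stab" "x \<in> carrier R" "g x \<noteq> x" "g x \<noteq> inv x"
      by (auto simp: fixed_or_inverted_def)
    then show "\<exists>t\<in>carrier R. t \<noteq> x \<and> t \<noteq> inv x \<and> (\<forall>S\<in>T. x \<in> S \<longleftrightarrow> t \<in> S)"
      using G_closed[OF stab_sub[OF g(1)] g(2)] by (intro bexI[of _ "g x"]) (auto simp: T_def)
  qed (auto simp: T_def)
  ultimately show ?thesis by linarith
qed

lemma dense_inverted:
  assumes "24 * card (carrier R - fixed_or_inverted) < order R"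
  shows "dense_inverted R fixed fixed_or_inverted"
proof (intro dense_inverted.intro dense_inverted_axioms.intro)
  show "group R" "finite (carrier R)" "subgroup fixed R" "fixed \<noteq> carrier R"
    by (fact group_axioms fin subgroup_fixed fixed_proper)+
  show "fixed \<subseteq> fixed_or_inverted" "fixed_or_inverted \<subseteq> carrier R"
    by (auto simp: fixed_def fixed_or_inverted_def)
  show "24 * card (carrier R - fixed_or_inverted) < order R" by fact
  show "inv x \<in> fixed_or_inverted" if "x \<in> fixed_or_inverted" for x
    using that by (rule fixed_or_inverted_inv)
  show "inv x \<noteq> x" if "x \<in> fixed_or_inverted" "x \<notin> fixed" for x
    using that by (force simp: fixed_def fixed_or_inverted_def)
next
  fix y x
  assume y: "y \<in> fixed_or_inverted" and x: "x \<in> fixed_or_inverted"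
    and yx: "y \<otimes> x \<in> fixed_or_inverted" "y \<otimes> x \<notin> fixed"
  have xc: "x \<in> carrier R" "y \<in> carrier R" using x y by (auto simp: fixed_or_inverted_def)
  obtain g where g: "g \<in> stab" "g (y \<otimes> x) \<noteq> y \<otimes> x"
    using yx xc by (auto simp: fixed_def)
  then have inv: "g (y \<otimes> x) = inv (y \<otimes> x)" using yx(1) by (auto simp: fixed_or_inverted_def)
  obtain g' where g': "g' \<in> stab" "\<And>y. y \<in> carrier R \<Longrightarrow> g (y \<otimes> x) = g' y \<otimes> g x"
    using stab_cocycle[OF g(1) xc(1)] by auto
  have "inv (y \<otimes> x) = g' y \<otimes> g x" using inv g'(2)[OF xc(2)] by simp
  moreover have "g' y \<in> {y, inv y}" "g x \<in> {x, inv x}" "x \<in> fixed \<longrightarrow> g x = x"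
    using x y g(1) g'(1) by (auto simp: fixed_or_inverted_def fixed_def)
  ultimately show "\<exists>y'\<in>{y, inv y}. \<exists>x'\<in>{x, inv x}. inv (y \<otimes> x) = y' \<otimes> x' \<and> (x \<in> fixed \<longrightarrow> x' = x)"
    by blast
qed

end

theorem theorem1p9:
  fixes R :: "('a, 'b) monoid_scheme" and G :: "('a \<Rightarrow> 'a) set"
  assumes "group R" and "finite (carrier R)"
    and "subgroup G (BijGroup (carrier R))"
    and "transitive_action (BijGroup (carrier R)\<lparr>carrier := G\<rparr>) (carrier R) (\<lambda>g. g)"
    and "right_regular R \<subset> G"
  shows "real (card {\<Gamma> \<in> cayley_graphs R. G \<subseteq> digraph_auts \<Gamma>})
           \<le> 2 powr (cayley_exponent R - real (order R) / 96)
    \<or> comm_group R \<and> group_exponent R > 2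
    \<or> generalised_dicyclic R"
proof -
  interpret regular_overgroup R G
    using assms by (simp add: regular_overgroup_def regular_overgroup_axioms_def)
  let ?N = "carrier R - fixed_or_inverted"
  show ?thesis
  proof (cases "24 * card ?N < order R")
    case True
    then show ?thesis using dense_inverted.abelian_or_dicyclic[OF dense_inverted] by blast
  next
    case False
    then have "real (order R) / 96 \<le> real (card ?N) / 4" by simp
    then have "2 powr (cayley_exponent R - real (card ?N) / 4)
        \<le> 2 powr (cayley_exponent R - real (order R) / 96)" by (intro powr_mono) auto
    then show ?thesis using card_cayley_graphs_le by linarith
  qed
qed

end
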